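(* Let $n$ be a positive integer with $n\in 4\mathbb{Z}$, let $\Omega=\{1,\ldots,n\}$, and let $\mathcal{C}\subseteq\mathcal{E}(\Omega)$ be a binary linear code such that $\Omega\in\mathcal{C}$ and such that for any distinct $i,j\in\Omega$ there is some $T_{ij}\in\mathcal{C}$ with $i\in T_{ij}$ and $j\notin T_{ij}$. Then the vertex subring $L(\frac12,0)^{\otimes n}_{\mathcal{C}}$ of $L(\frac12,0)^{\otimes n}$ generated by the vectors $\omega_T$, $T\in\mathcal{C}$, is an integral form of the vertex operator algebra $L(\frac12,0)^{\otimes n}$, and it contains the conformal vector $\omega$ of $L(\frac12,0)^{\otimes n}$.
   Context: Vertex operator algebras are over $\mathbb{C}$, with the usual definition (vacuum $\mathbf 1$, conformal vector, $L(0)$-grading by conformal weight with finite-dimensional weight spaces). For $u$ in a vertex operator algebra write $Y(u,x)=\sum_{m\in\mathbb{Z}}u_m x^{-m-1}$. A vertex subring of $V$ is an additive subgroup containing $\mathbf 1$ and closed under all products $(u,v)\mapsto u_mv$, $m\in\mathbb{Z}$; the vertex subring generated by a subset is the smallest vertex subring containing it. An integral form of a vertex operator algebra $V$ is a vertex subring $V_\mathbb{Z}\subseteq V$ which is the $\mathbb{Z}$-span of a $\mathbb{C}$-basis of $V$ and is compatible with the weight grading: $V_\mathbb{Z}=\coprod_{m\in\mathbb{Z}}V_{(m)}\cap V_\mathbb{Z}$, where $V_{(m)}$ is the $L(0)$-eigenspace with eigenvalue $m$. For $\ell,h\in\mathbb{C}$, $L(\ell,h)$ is the irreducible lowest weight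 module for the Virasoro algebra of central charge $\ell$ and lowest conformal weight $h$ (the irreducible quotient of the Verma module $M(\ell,h)$). $L(\frac12,0)$ is the simple Virasoro vertex operator algebra of central charge $\frac12$, with conformal vector $L(-2)\mathbf 1$. The tensor power $L(\frac12,0)^{\otimes n}$ is the usual tensor product vertex operator algebra; for $1\le i\le n$ let $\omega^{(i)}$ be the vector with the conformal vector of $L(\frac12,0)$ in the $i$-th tensor factor and $\mathbf 1$ in all others, so the conformal vector of $L(\frac12,0)^{\otimes n}$ is $\omega=\sum_{i=1}^n\omega^{(i)}$. For a finite set $\Omega$, the power set $P(\Omega)$ is an $\mathbb{F}_2$-vector space under symmetric difference; a binary linear code is an $\mathbb{F}_2$-subspace of $P(\Omega)$; $\mathcal{E}(\Omega)=\{S\subseteq\Omega : |S|\in 2\mathbb{Z}\}$. For $T\subseteq\Omega=\{1,\ldots,n\}$ set $\omega_T=\sum_{i\notin T}\omega^{(i)}-\sum_{i\in T}\omega^{(i)}$. *)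

theory Defs
  imports Complex_Main "HOL-Library.FuncSet" "HOL-Library.Poly_Mapping"
begin

section \<open>Modules for the Virasoro algebra\<close>

text \<open>
  A module for the Virasoro algebra on a complex vector space (all of type \<open>'v\<close>, with scalar
  multiplication \<open>s\<close>) on which the central element acts as the scalar \<open>c\<close>; \<open>L n\<close> is the action of
  the standard generator of index \<open>n\<close>.
\<close>

locale virasoro_module = vector_space s
  for s :: "complex \<Rightarrow> 'v::ab_group_add \<Rightarrow> 'v" +
  fixes L :: "int \<Rightarrow> 'v \<Rightarrow> 'v" and c :: complex
  assumes L_linear: "Vector_Spaces.linear s s (L m)"
    and L_bracket: "L m (L n v) - L n (L m v) =
      s (of_int (m - n)) (L (m + n) v) +
      (if m + n = 0 then s (of_int (m ^ 3 - m) / 12 * c) v else 0)"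
begin

definition submodule :: "'v set \<Rightarrow> bool" where
  "submodule W \<longleftrightarrow> subspace W \<and> (\<forall>m. \<forall>w\<in>W. L m w \<in> W)"

definition irreducible_module :: bool where
  "irreducible_module \<longleftrightarrow>
     (\<exists>v::'v. v \<noteq> 0) \<and> (\<forall>W. submodule W \<longrightarrow> W = {0} \<or> W = UNIV)"

text \<open>The module is generated by a lowest weight vector \<open>v\<close> of conformal weight \<open>h\<close>.\<close>

definition lowest_weight_module :: "complex \<Rightarrow> 'v \<Rightarrow> bool" where
  "lowest_weight_module h v \<longleftrightarrow>
     v \<noteq> 0 \<and> L 0 v = s h v \<and> (\<forall>m>0. L m v = 0) \<and>
     (\<forall>W. submodule W \<and> v \<in> W \<longrightarrow> W = UNIV)"

end

text \<open>
  \<open>L(c,h)\<close> is determined up to isomorphism as the irreducible lowest weight module of central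
  charge \<open>c\<close> and lowest conformal weight \<open>h\<close>; the predicate says that the given module, with the
  given lowest weight vector, is a realization of it.
\<close>

definition is_virasoro_L ::
    "complex \<Rightarrow> complex \<Rightarrow> (complex \<Rightarrow> 'v::ab_group_add \<Rightarrow> 'v) \<Rightarrow> (int \<Rightarrow> 'v \<Rightarrow> 'v) \<Rightarrow> 'v \<Rightarrow> bool" where
  "is_virasoro_L c h s L v \<longleftrightarrow>
     virasoro_module s L c \<and> virasoro_module.irreducible_module s L \<and>
     virasoro_module.lowest_weight_module s L h v"


section \<open>Vertex operator algebras\<close>

text \<open>\<open>vprod V u m v\<close> is the product \<open>u\<^sub>m v\<close>, where \<open>Y(u,x) = \<Sum>\<^sub>m u\<^sub>m x\<^sup>-\<^sup>m\<^sup>-\<^sup>1\<close>.\<close>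

record 'v vertex_data =
  vscale :: "complex \<Rightarrow> 'v \<Rightarrow> 'v"
  vprod :: "'v \<Rightarrow> int \<Rightarrow> 'v \<Rightarrow> 'v"
  vacuum :: 'v
  conformal :: 'v

definition Lop :: "'v vertex_data \<Rightarrow> int \<Rightarrow> 'v \<Rightarrow> 'v" where
  "Lop V m v = vprod V (conformal V) (m + 1) v"

definition weight_space :: "'v vertex_data \<Rightarrow> int \<Rightarrow> 'v set" where
  "weight_space V m = {v. Lop V 0 v = vscale V (of_int m) v}"

text \<open>\<open>A\<close> is the internal direct sum of the family \<open>W\<close> (used for additive subgroups only).\<close>

definition is_coproduct :: "'v::ab_group_add set \<Rightarrow> (int \<Rightarrow> 'v set) \<Rightarrow> bool" where
  "is_coproduct A W \<longleftrightarrow>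
     (\<forall>m. W m \<subseteq> A) \<and>
     (\<forall>v\<in>A. \<exists>!f. finite {m. f m \<noteq> 0} \<and> (\<forall>m. f m \<in> W m) \<and> v = Sum_any f)"

text \<open>
  The Jacobi identity is stated in components (the coefficients of the delta function identity).
  All sums occurring in it are finite by \<open>truncation\<close>; \<open>Sum_any\<close> sums over the support.
\<close>

locale vertex_operator_algebra = vector_space "vscale V"
  for V :: "'v::ab_group_add vertex_data" +
  fixes c :: complex
  assumes prod_linear_left: "Vector_Spaces.linear (vscale V) (vscale V) (\<lambda>u. vprod V u m v)"
    and prod_linear_right: "Vector_Spaces.linear (vscale V) (vscale V) (\<lambda>v. vprod V u m v)"
    and truncation: "\<exists>N. \<forall>m\<ge>N. vprod V u m v = 0"
    and vacuum_left: "vprod V (vacuum V) m v = (if m = -1 then v else 0)"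
    and creation: "vprod V u (-1) (vacuum V) = u"
      "m \<ge> 0 \<Longrightarrow> vprod V u m (vacuum V) = 0"
    and jacobi:
      "Sum_any (\<lambda>i::nat. vscale V (of_int p gchoose i)
          (vprod V (vprod V u (r + int i) v) (p + q - int i) w)) =
       Sum_any (\<lambda>i::nat. vscale V ((-1) ^ i * (of_int r gchoose i))
          (vprod V u (p + r - int i) (vprod V v (q + int i) w))) -
       Sum_any (\<lambda>i::nat. vscale V ((-1) ^ i * ((-1) powi r) * (of_int r gchoose i))
          (vprod V v (q + r - int i) (vprod V u (p + int i) w)))"
    and virasoro: "virasoro_module (vscale V) (Lop V) c"
    and derivative: "vprod V (Lop V (-1) u) m v = vscale V (- of_int m) (vprod V u (m - 1) v)"
    and grading: "is_coproduct UNIV (weight_space V)"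
    and weight_space_finite_dim: "\<exists>B. finite B \<and> span B = weight_space V m"
    and weight_bounded_below: "\<exists>N. \<forall>m<N. weight_space V m = {0}"

text \<open>
  The vertex operator algebra \<open>L(c,0)\<close>: the Virasoro module structure given by the components of
  the conformal vector is \<open>L(c,0)\<close>, with lowest weight vector \<open>\<one>\<close>. The conformal vector is then
  \<open>L(-2)\<one>\<close> by the creation property.
\<close>

definition is_virasoro_voa :: "complex \<Rightarrow> 'v::ab_group_add vertex_data \<Rightarrow> bool" where
  "is_virasoro_voa c V \<longleftrightarrow>
     vertex_operator_algebra V c \<and> is_virasoro_L c 0 (vscale V) (Lop V) (vacuum V)"

lemma conformal_eq_Lop_vacuum:
  assumes "vertex_operator_algebra V c"
  shows "conformal V = Lop V (-2) (vacuum V)"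
  using vertex_operator_algebra.creation(1)[OF assms] by (simp add: Lop_def)


section \<open>Tensor powers\<close>

text \<open>
  Families in the tensor factors are extensional functions in \<open>I \<rightarrow>\<^sub>E UNIV\<close>. The tensor power is
  the vector space with basis the set of families, modulo the multilinearity relations.
\<close>

definition free_scale :: "complex \<Rightarrow> ('x \<Rightarrow>\<^sub>0 complex) \<Rightarrow> ('x \<Rightarrow>\<^sub>0 complex)" where
  "free_scale a f = Poly_Mapping.map ((*) a) f"

lemma lookup_free_scale: "Poly_Mapping.lookup (free_scale a f) x = a * Poly_Mapping.lookup f x"
  by (simp add: free_scale_def Poly_Mapping.map.rep_eq when_def)

lemma vector_space_free_scale: "vector_space free_scale"
  by unfold_locales
    (simp_all add: poly_mapping_eq_iff fun_eq_iff lookup_free_scale lookup_add algebra_simps)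

definition tensor_relators ::
    "'i set \<Rightarrow> (complex \<Rightarrow> 'a::ab_group_add \<Rightarrow> 'a) \<Rightarrow> (('i \<Rightarrow> 'a) \<Rightarrow>\<^sub>0 complex) set" where
  "tensor_relators I s =
     {Poly_Mapping.single (u(i := x + y)) 1 - Poly_Mapping.single (u(i := x)) 1
        - Poly_Mapping.single (u(i := y)) 1 | u i x y. u \<in> I \<rightarrow>\<^sub>E UNIV \<and> i \<in> I} \<union>
     {Poly_Mapping.single (u(i := s a x)) 1 - Poly_Mapping.single (u(i := x)) a
        | u i a x. u \<in> I \<rightarrow>\<^sub>E UNIV \<and> i \<in> I}"

definition linear_extension ::
    "(complex \<Rightarrow> 'b::ab_group_add \<Rightarrow> 'b) \<Rightarrow> ('x \<Rightarrow> 'b) \<Rightarrow> ('x \<Rightarrow>\<^sub>0 complex) \<Rightarrow> 'b" where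
  "linear_extension s \<tau> f =
     (\<Sum>u \<in> Poly_Mapping.keys f. s (Poly_Mapping.lookup f u) (\<tau> u))"

text \<open>
  The space with scalar multiplication \<open>s'\<close> is the \<open>I\<close>-fold tensor power of the space with scalar
  multiplication \<open>s\<close>, the tensor of a family \<open>u\<close> being \<open>\<tau> u\<close>.
\<close>

definition is_tensor_power ::
    "'i set \<Rightarrow> (complex \<Rightarrow> 'a::ab_group_add \<Rightarrow> 'a) \<Rightarrow> (complex \<Rightarrow> 'b::ab_group_add \<Rightarrow> 'b) \<Rightarrow>
     (('i \<Rightarrow> 'a) \<Rightarrow> 'b) \<Rightarrow> bool" where
  "is_tensor_power I s s' \<tau> \<longleftrightarrow>
     vector_space s \<and> vector_space s' \<and>
     linear_extension s' \<tau> ` {f. Poly_Mapping.keys f \<subseteq> I \<rightarrow>\<^sub>E UNIV} = UNIV \<and>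
     {f. Poly_Mapping.keys f \<subseteq> I \<rightarrow>\<^sub>E UNIV \<and> linear_extension s' \<tau> f = 0} =
       module.span free_scale (tensor_relators I s)"

definition conformal_at ::
    "'i set \<Rightarrow> 'a vertex_data \<Rightarrow> (('i \<Rightarrow> 'a) \<Rightarrow> 'b) \<Rightarrow> 'i \<Rightarrow> 'b" where
  "conformal_at I L \<tau> i = \<tau> ((\<lambda>j\<in>I. vacuum L)(i := conformal L))"

text \<open>
  The vertex operators are \<open>Y(\<otimes>\<^sub>i u\<^sub>i, x) = \<Otimes>\<^sub>i Y(u\<^sub>i, x)\<close>. The coefficient of \<open>x\<^sup>-\<^sup>m\<^sup>-\<^sup>1\<close> collects the
  tuples of indices \<open>k\<close> with \<open>\<Sum>\<^sub>i (- k\<^sub>i - 1) = - m - 1\<close>; by truncation only finitely many of them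
  contribute.
\<close>

definition is_tensor_power_voa ::
    "'i set \<Rightarrow> complex \<Rightarrow> 'a::ab_group_add vertex_data \<Rightarrow> 'b::ab_group_add vertex_data \<Rightarrow>
     (('i \<Rightarrow> 'a) \<Rightarrow> 'b) \<Rightarrow> bool" where
  "is_tensor_power_voa I c L V \<tau> \<longleftrightarrow>
     vertex_operator_algebra L c \<and>
     vertex_operator_algebra V (of_nat (card I) * c) \<and>
     is_tensor_power I (vscale L) (vscale V) \<tau> \<and>
     vacuum V = \<tau> (\<lambda>i\<in>I. vacuum L) \<and>
     conformal V = (\<Sum>i\<in>I. conformal_at I L \<tau> i) \<and>
     (\<forall>u \<in> I \<rightarrow>\<^sub>E UNIV. \<forall>v \<in> I \<rightarrow>\<^sub>E UNIV. \<forall>m.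
        vprod V (\<tau> u) m (\<tau> v) =
        Sum_any (\<lambda>k. if k \<in> I \<rightarrow>\<^sub>E UNIV \<and> (\<Sum>i\<in>I. - k i - 1) = - m - 1
                     then \<tau> (\<lambda>i\<in>I. vprod L (u i) (k i) (v i)) else 0))"


section \<open>Vertex subrings and integral forms\<close>

definition vertex_subring :: "'v::ab_group_add vertex_data \<Rightarrow> 'v set \<Rightarrow> bool" where
  "vertex_subring V R \<longleftrightarrow>
     0 \<in> R \<and> (\<forall>u\<in>R. \<forall>v\<in>R. u + v \<in> R) \<and> (\<forall>u\<in>R. - u \<in> R) \<and>
     vacuum V \<in> R \<and> (\<forall>u\<in>R. \<forall>v\<in>R. \<forall>m. vprod V u m v \<in> R)"

definition generated_vertex_subring :: "'v::ab_group_add vertex_data \<Rightarrow> 'v set \<Rightarrow> 'v set" where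
  "generated_vertex_subring V S = \<Inter>{R. vertex_subring V R \<and> S \<subseteq> R}"

definition integral_form :: "'v::ab_group_add vertex_data \<Rightarrow> 'v set \<Rightarrow> bool" where
  "integral_form V R \<longleftrightarrow>
     vertex_subring V R \<and>
     (\<exists>B. \<not> module.dependent (vscale V) B \<and> module.span (vscale V) B = UNIV \<and>
          R = module.span (\<lambda>k::int. vscale V (of_int k)) B) \<and>
     is_coproduct R (\<lambda>m. weight_space V m \<inter> R)"


section \<open>Binary codes\<close>

definition binary_linear_code :: "'i set \<Rightarrow> 'i set set \<Rightarrow> bool" where
  "binary_linear_code \<Omega> C \<longleftrightarrow>
     C \<subseteq> Pow \<Omega> \<and> {} \<in> C \<and> (\<forall>S\<in>C. \<forall>T\<in>C. sym_diff S T \<in> C)"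

definition even_subsets :: "'i set \<Rightarrow> 'i set set" where
  "even_subsets \<Omega> = {S. S \<subseteq> \<Omega> \<and> even (card S)}"

definition signed_conformal ::
    "'i set \<Rightarrow> 'a vertex_data \<Rightarrow> (('i \<Rightarrow> 'a) \<Rightarrow> 'b::ab_group_add) \<Rightarrow> 'i set \<Rightarrow> 'b" where
  "signed_conformal \<Omega> L \<tau> T =
     (\<Sum>i\<in>\<Omega> - T. conformal_at \<Omega> L \<tau> i) - (\<Sum>i\<in>T. conformal_at \<Omega> L \<tau> i)"

end

theory Submission
  imports Defs
begin

text \<open>
  The modes \<open>L\<^sub>T(m)\<close> of the vectors \<open>\<omega>\<^sub>T\<close> satisfy
  \<open>[L\<^sub>T(m), L\<^sub>S(p)] = (m - p) L\<^sub>T\<^sub>+\<^sub>S(m + p)\<close> plus a central term which the divisibility assumptions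
  make integral. Moving modes with \<open>m \<ge> -1\<close> to the right, where they annihilate the vacuum, shows that
  the generated vertex subring is the \<open>\<int>\<close>-span of the monomials in the \<open>L\<^sub>T(m)\<close> with \<open>m \<le> -2\<close> applied
  to the vacuum. Orthogonality of the characters of the code recovers the modes of each \<open>\<omega>\<^sup>(\<^sup>i\<^sup>)\<close> over
  \<open>\<complex>\<close>, so this subring spans \<open>V\<close>, and by irreducibility of the tensor factors the coefficients of the
  vacuum in the vectors \<open>L\<^sub>T\<^sub>1(m\<^sub>1) \<dots> L\<^sub>T\<^sub>k(m\<^sub>k) v\<close> determine \<open>v\<close>. These functionals are
  integral on the subring, which makes each of its weight spaces a lattice of full rank.
\<close>

section \<open>Lattices cut out by integral functionals\<close>

text \<open>Restriction of scalars to the integers makes spans and submodules with integer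
  coefficients available inside the same vector space.\<close>

lemma module_of_int:
  fixes s :: "'k::field \<Rightarrow> 'v::ab_group_add \<Rightarrow> 'v"
  assumes "vector_space s"
  shows "module (\<lambda>k::int. s (of_int k))"
proof -
  interpret vector_space s by fact
  show ?thesis by unfold_locales (simp_all add: algebra_simps)
qed

lemma int_subspaceI:
  fixes s :: "'k::field \<Rightarrow> 'v::ab_group_add \<Rightarrow> 'v"
  assumes s: "vector_space s" and "0 \<in> R" and add: "\<And>u v. u \<in> R \<Longrightarrow> v \<in> R \<Longrightarrow> u + v \<in> R"
    and neg: "\<And>u. u \<in> R \<Longrightarrow> - u \<in> R"
  shows "module.subspace (\<lambda>k::int. s (of_int k)) R"
proof -
  interpret vector_space s by fact
  interpret Z: module "\<lambda>k::int. s (of_int k)" by (rule module_of_int[OF s])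
  have "s (of_int k) v \<in> R" if v: "v \<in> R" for k :: int and v
  proof (induction k rule: int_induct[where k=0])
    case base
    then show ?case using \<open>0 \<in> R\<close> by simp
  next
    case (step1 i)
    then show ?case using add[OF step1(2) v] by (simp add: scale_left_distrib)
  next
    case (step2 i)
    then show ?case using add[OF step2(2) neg[OF v]] by (simp add: scale_left_diff_distrib)
  qed
  then show ?thesis
    unfolding Z.subspace_def using \<open>0 \<in> R\<close> add by blast
qed

text \<open>Induction on the rank: an integral functional that is nonzero on \<open>R\<close> maps
  it onto a nonzero ideal of the integers, and a preimage of the generator together with a basis of
  the kernel is a basis of \<open>R\<close>. The functionals exclude subgroups such as the one
  generated by 1 and sqrt 2 in the reals.\<close>

lemma lattice_basis:
  fixes s :: "'k::field_char_0 \<Rightarrow> 'v::ab_group_add \<Rightarrow> 'v" and \<Phi> :: "('v \<Rightarrow> 'k) set"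
  assumes s: "vector_space s"
    and lin: "\<And>\<phi>. \<phi> \<in> \<Phi> \<Longrightarrow> Vector_Spaces.linear s (*) \<phi>"
    and "module.subspace (\<lambda>k::int. s (of_int k)) R"
    and "\<And>v. v \<in> R \<Longrightarrow> v \<noteq> 0 \<Longrightarrow> \<exists>\<phi>\<in>\<Phi>. \<phi> v \<noteq> 0"
    and "\<And>\<phi> v. \<phi> \<in> \<Phi> \<Longrightarrow> v \<in> R \<Longrightarrow> \<phi> v \<in> \<int>"
    and "finite F" and "R \<subseteq> module.span s F"
  shows "\<exists>B. \<not> module.dependent s B \<and> R = module.span (\<lambda>k::int. s (of_int k)) B"
proof -
  interpret vector_space s by fact
  interpret Z: module "\<lambda>k::int. s (of_int k)" by (rule module_of_int[OF s])
  \<comment> \<open>The induction parameter \<open>d\<close> bounds the subsets of \<open>R\<close>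
    that are independent over the field. It drops on passing to the kernel of a functional, because
    \<open>r\<close> can be adjoined to any independent subset of the kernel.\<close>
  have main: "\<exists>B. independent B \<and> R = Z.span B"
    if "Z.subspace R" and "\<And>v. v \<in> R \<Longrightarrow> v \<noteq> 0 \<Longrightarrow> \<exists>\<phi>\<in>\<Phi>. \<phi> v \<noteq> 0"
      and "\<And>\<phi> v. \<phi> \<in> \<Phi> \<Longrightarrow> v \<in> R \<Longrightarrow> \<phi> v \<in> \<int>"
      and "\<And>B. independent B \<Longrightarrow> B \<subseteq> R \<Longrightarrow> finite B \<and> card B \<le> d" for R d
    using that
  proof (induction d arbitrary: R)
    case 0
    have "R = {0}"
    proof (rule ccontr)
      assume "R \<noteq> {0}"
      then obtain r where "r \<in> R" "r \<noteq> 0"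
        using Z.subspace_0[OF "0.prems"(1)] by auto
      then show False
        using "0.prems"(4)[of "{r}"] by (simp add: dependent_single)
    qed
    then show ?case
      by (intro exI[of _ "{}"]) (simp add: independent_empty)
  next
    case (Suc d)
    show ?case
    proof (cases "R = {0}")
      case True
      then show ?thesis
        by (intro exI[of _ "{}"]) (simp add: independent_empty)
    next
      case False
      then obtain r where r: "r \<in> R" "r \<noteq> 0"
        using Z.subspace_0[OF Suc.prems(1)] by auto
      then obtain \<phi> where \<phi>: "\<phi> \<in> \<Phi>" "\<phi> r \<noteq> 0"
        using Suc.prems(2) by blast
      have hom: "module_hom s (*) \<phi>"
        using lin[OF \<phi>(1)] by (simp add: module_hom_iff_linear)
      note \<phi>_simps = module_hom.add[OF hom] module_hom.scale[OF hom] module_hom.zero[OF hom]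
        module_hom.neg[OF hom] module_hom.diff[OF hom]
      define R' where "R' = {v \<in> R. \<phi> v = 0}"
      have span_R': "v \<in> span B \<Longrightarrow> \<phi> v = 0" if "B \<subseteq> R'" for B v
        using that module_hom.eq_0_on_span[OF hom, of B v] by (auto simp: R'_def)
      have ind: "independent (insert v B)" "v \<notin> B" if "independent B" "B \<subseteq> R'" "\<phi> v \<noteq> 0" for v B
        using that span_R'[OF that(2)] span_base by (auto simp: independent_insert)
      have "\<exists>B. independent B \<and> R' = Z.span B"
      proof (rule Suc.IH)
        show "Z.subspace R'"
          using Suc.prems(1) unfolding R'_def Z.subspace_def
          by (auto simp: \<phi>_simps)
        fix B assume B: "independent B" "B \<subseteq> R'"
        then have "finite (insert r B) \<and> card (insert r B) \<le> Suc d"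
          using r ind[OF B \<phi>(2)] by (intro Suc.prems(4)) (auto simp: R'_def)
        then show "finite B \<and> card B \<le> d"
          using ind(2)[OF B \<phi>(2)] by auto
      qed (use Suc.prems in \<open>auto simp: R'_def\<close>)
      then obtain B where B: "independent B" "R' = Z.span B" by blast
      \<comment> \<open>The positive values of \<open>\<phi>\<close> on \<open>R\<close>; the least
        one, \<open>g\<close>, generates the image of \<open>R\<close>.\<close>
      define A where "A = {k::nat. k > 0 \<and> (\<exists>v\<in>R. \<phi> v = of_nat k)}"
      obtain k :: int where k: "\<phi> r = of_int k"
        using Suc.prems(3)[OF \<phi>(1) r(1)] by (auto elim: Ints_cases)
      have "nat \<bar>k\<bar> \<in> A"
      proof (cases "k > 0")
        case True
        then show ?thesis using r(1) k by (auto simp: A_def of_nat_nat intro!: bexI[of _ r])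
      next
        case False
        then have "\<phi> (- r) = of_nat (nat \<bar>k\<bar>)" using k by (simp add: \<phi>_simps)
        moreover have "k \<noteq> 0" using k \<phi>(2) by auto
        ultimately show ?thesis
          using Z.subspace_neg[OF Suc.prems(1) r(1)] by (auto simp: A_def)
      qed
      define g where "g = (LEAST k. k \<in> A)"
      have "g \<in> A" unfolding g_def using \<open>nat \<bar>k\<bar> \<in> A\<close> by (rule LeastI)
      then obtain r0 where g: "g > 0" and r0: "r0 \<in> R" "\<phi> r0 = of_nat g"
        by (auto simp: A_def)
      \<comment> \<open>Division with remainder by \<open>g\<close>: a nonzero remainder would be a
        smaller positive value.\<close>
      have dec: "\<exists>q::int. v - s (of_int q) r0 \<in> R'" if v: "v \<in> R" for v
      proof -
        obtain k :: int where k: "\<phi> v = of_int k"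
          using Suc.prems(3)[OF \<phi>(1) v] by (auto elim: Ints_cases)
        define q where "q = k div int g"
        define w where "w = v - s (of_int q) r0"
        have w: "w \<in> R"
          unfolding w_def by (intro Z.subspace_diff Z.subspace_scale Suc.prems v r0)
        have "\<phi> w = of_int (k - q * int g)"
          by (simp add: w_def \<phi>_simps k r0)
        also have "k - q * int g = k mod int g"
          by (simp add: q_def minus_div_mult_eq_mod)
        finally have \<phi>w: "\<phi> w = of_int (k mod int g)" .
        have "k mod int g = 0"
        proof (rule ccontr)
          assume "k mod int g \<noteq> 0"
          moreover have "0 \<le> k mod int g" "k mod int g < int g" using g by auto
          ultimately have "nat (k mod int g) \<in> A" "nat (k mod int g) < g"
            using w \<phi>w by (auto simp: A_def intro!: bexI[of _ w])
          then show False unfolding g_def using not_less_Least by blast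
        qed
        then show ?thesis using w \<phi>w by (auto simp: R'_def w_def)
      qed
      have "B \<subseteq> R'" using B(2) Z.span_superset by blast
      have "R = Z.span (insert r0 B)"
      proof
        show "R \<subseteq> Z.span (insert r0 B)"
          using dec B(2) by (auto simp: Z.span_insert)
        show "Z.span (insert r0 B) \<subseteq> R"
          using r0(1) \<open>B \<subseteq> R'\<close> Suc.prems(1) by (intro Z.span_minimal) (auto simp: R'_def)
      qed
      moreover have "independent (insert r0 B)"
        using g r0(2) by (intro ind B \<open>B \<subseteq> R'\<close>) auto
      ultimately show ?thesis by blast
    qed
  qed
  show ?thesis
  proof (rule main[of R "card F"])
    show "finite B \<and> card B \<le> card F" if "independent B" "B \<subseteq> R" for B
      using independent_span_bound[OF \<open>finite F\<close> that(1)] that(2) assms(7) by blast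
  qed (use assms(3-5) in simp_all)
qed

section \<open>Tensor powers\<close>

lemma linear_extension_superset:
  assumes "vector_space s" "finite A" "Poly_Mapping.keys f \<subseteq> A"
  shows "linear_extension s \<tau> f = (\<Sum>u\<in>A. s (Poly_Mapping.lookup f u) (\<tau> u))"
proof -
  interpret vector_space s by fact
  show ?thesis
    unfolding linear_extension_def
    by (rule sum.mono_neutral_left) (use assms in \<open>auto simp: in_keys_iff\<close>)
qed

lemma linear_extension_single:
  assumes "vector_space s"
  shows "linear_extension s \<tau> (Poly_Mapping.single u a) = s a (\<tau> u)"
  using linear_extension_superset[OF assms, of "{u}" "Poly_Mapping.single u a" \<tau>] by simp

lemma linear_linear_extension:
  assumes s: "vector_space s"
  shows "Vector_Spaces.linear free_scale s (linear_extension s \<tau>)"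
proof -
  interpret vector_space s by fact
  have "linear_extension s \<tau> (f + g) = linear_extension s \<tau> f + linear_extension s \<tau> g" for f g
  proof -
    let ?A = "Poly_Mapping.keys f \<union> Poly_Mapping.keys g"
    have "linear_extension s \<tau> h = (\<Sum>u\<in>?A. s (Poly_Mapping.lookup h u) (\<tau> u))"
      if "h \<in> {f, g, f + g}" for h
      using that keys_add[of f g] by (intro linear_extension_superset s) auto
    then show ?thesis
      by (simp add: lookup_add scale_left_distrib sum.distrib)
  qed
  moreover have "linear_extension s \<tau> (free_scale a f) = s a (linear_extension s \<tau> f)" for a f
  proof -
    have "linear_extension s \<tau> (free_scale a f) =
        (\<Sum>u\<in>Poly_Mapping.keys f. s (Poly_Mapping.lookup (free_scale a f) u) (\<tau> u))"
      by (rule linear_extension_superset[OF s]) (auto simp: in_keys_iff lookup_free_scale)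
    then show ?thesis
      by (simp add: lookup_free_scale linear_extension_def scale_sum_right)
  qed
  ultimately show ?thesis
    unfolding module_hom_iff_linear[symmetric] module_hom_def module_hom_axioms_def
      module_iff_vector_space
    using vector_space_free_scale s by blast
qed

definition multilinear_on ::
    "'i set \<Rightarrow> (complex \<Rightarrow> 'a::ab_group_add \<Rightarrow> 'a) \<Rightarrow> (complex \<Rightarrow> 'b::ab_group_add \<Rightarrow> 'b) \<Rightarrow>
     (('i \<Rightarrow> 'a) \<Rightarrow> 'b) \<Rightarrow> bool" where
  "multilinear_on I s t F \<longleftrightarrow>
     (\<forall>u \<in> I \<rightarrow>\<^sub>E UNIV. \<forall>i\<in>I. Vector_Spaces.linear s t (\<lambda>x. F (u(i := x))))"

lemma fun_upd_extensional [simp]: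
  "u \<in> I \<rightarrow>\<^sub>E UNIV \<Longrightarrow> i \<in> I \<Longrightarrow> u(i := x) \<in> I \<rightarrow>\<^sub>E UNIV"
  by (auto simp: PiE_def extensional_def)

lemma linear_extension_relator:
  assumes F: "multilinear_on I s t F" and "vector_space t" and r: "r \<in> tensor_relators I s"
  shows "linear_extension t F r = 0"
proof -
  have hom: "module_hom free_scale t (linear_extension t F)"
    using linear_linear_extension[OF \<open>vector_space t\<close>] by (simp add: module_hom_iff_linear)
  have F_hom: "module_hom s t (\<lambda>x. F (u(i := x)))" if "u \<in> I \<rightarrow>\<^sub>E UNIV" "i \<in> I" for u i
    using F that by (simp add: multilinear_on_def module_hom_iff_linear)
  interpret vector_space t by fact
  show ?thesis
    using r unfolding tensor_relators_def
    by (auto simp: module_hom.diff[OF hom] linear_extension_single[OF \<open>vector_space t\<close>]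
        module_hom.add[OF F_hom] module_hom.scale[OF F_hom])
qed

lemma tensor_power_multilinear:
  assumes tp: "is_tensor_power I s s' \<tau>"
  shows "multilinear_on I s s' \<tau>"
proof -
  have s: "vector_space s" and s': "vector_space s'" and
    ker: "{f. Poly_Mapping.keys f \<subseteq> I \<rightarrow>\<^sub>E UNIV \<and> linear_extension s' \<tau> f = 0} =
       module.span free_scale (tensor_relators I s)"
    using tp by (auto simp: is_tensor_power_def)
  interpret vector_space s' by fact
  interpret free: vector_space free_scale by (rule vector_space_free_scale)
  have hom: "module_hom free_scale s' (linear_extension s' \<tau>)"
    using linear_linear_extension[OF s'] by (simp add: module_hom_iff_linear)
  have rel: "linear_extension s' \<tau> r = 0" if "r \<in> tensor_relators I s" for r
    using ker free.span_base[OF that] by blast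
  have "module_hom s s' (\<lambda>x. \<tau> (u(i := x)))" if u: "u \<in> I \<rightarrow>\<^sub>E UNIV" and i: "i \<in> I" for u i
  proof -
    have "\<tau> (u(i := x + y)) = \<tau> (u(i := x)) + \<tau> (u(i := y))" for x y
    proof -
      have "linear_extension s' \<tau> (Poly_Mapping.single (u(i := x + y)) 1
          - Poly_Mapping.single (u(i := x)) 1 - Poly_Mapping.single (u(i := y)) 1) = 0"
        using u i by (intro rel) (auto simp: tensor_relators_def)
      then show ?thesis
        by (simp add: module_hom.diff[OF hom] module_hom.add[OF hom] linear_extension_single[OF s']
            diff_diff_eq)
    qed
    moreover have "\<tau> (u(i := s a x)) = s' a (\<tau> (u(i := x)))" for a x
    proof -
      have "linear_extension s' \<tau> (Poly_Mapping.single (u(i := s a x)) 1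
          - Poly_Mapping.single (u(i := x)) a) = 0"
        using u i by (intro rel) (unfold tensor_relators_def, blast)
      then show ?thesis
        by (simp add: module_hom.diff[OF hom] linear_extension_single[OF s'])
    qed
    ultimately show ?thesis
      using s s' by (simp add: module_hom_def module_hom_axioms_def module_iff_vector_space)
  qed
  then show ?thesis
    by (simp add: multilinear_on_def module_hom_iff_linear)
qed

text \<open>The universal property: two preimages of a vector in the free space differ by a
  combination of relators, on which the linear extension of \<open>F\<close> vanishes, so
  \<open>F\<close> descends to the quotient.\<close>

lemma tensor_power_lift:
  assumes tp: "is_tensor_power I s s' \<tau>" and F: "multilinear_on I s t F" and t: "vector_space t"
  shows "\<exists>G. Vector_Spaces.linear s' t G \<and> (\<forall>u \<in> I \<rightarrow>\<^sub>E UNIV. G (\<tau> u) = F u)"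
proof -
  define K :: "(('a \<Rightarrow> 'b) \<Rightarrow>\<^sub>0 complex) set" where "K = {f. Poly_Mapping.keys f \<subseteq> I \<rightarrow>\<^sub>E UNIV}"
  have s': "vector_space s'" and surj: "linear_extension s' \<tau> ` K = UNIV" and
    ker: "{f \<in> K. linear_extension s' \<tau> f = 0} = module.span free_scale (tensor_relators I s)"
    using tp by (auto simp: is_tensor_power_def K_def)
  interpret free: vector_space free_scale by (rule vector_space_free_scale)
  interpret t: vector_space t by fact
  interpret s': vector_space s' by fact
  have hom: "module_hom free_scale t (linear_extension t F)"
    using linear_linear_extension[OF t] by (simp add: module_hom_iff_linear)
  have hom': "module_hom free_scale s' (linear_extension s' \<tau>)"
    using linear_linear_extension[OF s'] by (simp add: module_hom_iff_linear)
  have K_add: "f + g \<in> K" and K_diff: "f - g \<in> K" if "f \<in> K" "g \<in> K" for f g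
    using that keys_add[of f g] keys_diff[of f g] by (auto simp: K_def)
  have K_scale: "free_scale a f \<in> K" if "f \<in> K" for a f
    using that by (auto simp: K_def in_keys_iff lookup_free_scale)
  have zero: "linear_extension t F f = 0" if "f \<in> K" "linear_extension s' \<tau> f = 0" for f
  proof -
    have "f \<in> free.span (tensor_relators I s)" using ker that by blast
    then show ?thesis
      using module_hom.eq_0_on_span[OF hom] linear_extension_relator[OF F t] by blast
  qed
  define G where "G v = linear_extension t F (SOME f. f \<in> K \<and> linear_extension s' \<tau> f = v)" for v
  have G: "G (linear_extension s' \<tau> f) = linear_extension t F f" if f: "f \<in> K" for f
  proof -
    define g where "g = (SOME g. g \<in> K \<and> linear_extension s' \<tau> g = linear_extension s' \<tau> f)"
    have "g \<in> K \<and> linear_extension s' \<tau> g = linear_extension s' \<tau> f"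
      unfolding g_def by (rule someI[of _ f]) (use f in simp)
    then have "linear_extension t F (g - f) = 0"
      using f by (intro zero K_diff) (simp_all add: module_hom.diff[OF hom'])
    then show ?thesis
      by (simp add: G_def g_def[symmetric] module_hom.diff[OF hom])
  qed
  have "module_hom s' t G"
  proof -
    have "G (x + y) = G x + G y" for x y
    proof -
      obtain f g where "f \<in> K" "x = linear_extension s' \<tau> f" "g \<in> K" "y = linear_extension s' \<tau> g"
        using surj by (metis UNIV_I imageE)
      then show ?thesis
        using G[of "f + g"] K_add by (simp add: G module_hom.add[OF hom] module_hom.add[OF hom'])
    qed
    moreover have "G (s' a x) = t a (G x)" for a x
    proof -
      obtain f where "f \<in> K" "x = linear_extension s' \<tau> f"
        using surj by (metis UNIV_I imageE)
      then show ?thesis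
        using G[of "free_scale a f"] K_scale
        by (simp add: G module_hom.scale[OF hom] module_hom.scale[OF hom'])
    qed
    ultimately show ?thesis
      using s' t by (simp add: module_hom_def module_hom_axioms_def module_iff_vector_space)
  qed
  moreover have "G (\<tau> u) = F u" if "u \<in> I \<rightarrow>\<^sub>E UNIV" for u
    using G[of "Poly_Mapping.single u 1"] that
    by (simp add: linear_extension_single[OF t] linear_extension_single[OF s'] K_def)
  ultimately show ?thesis
    by (auto simp: module_hom_iff_linear)
qed

lemma tensor_power_span:
  assumes tp: "is_tensor_power I s s' \<tau>"
  shows "module.span s' (\<tau> ` (I \<rightarrow>\<^sub>E UNIV)) = UNIV"
proof -
  interpret vector_space s' using tp by (simp add: is_tensor_power_def)
  have "v \<in> span (\<tau> ` (I \<rightarrow>\<^sub>E UNIV))" for v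
  proof -
    have "v \<in> linear_extension s' \<tau> ` {f. Poly_Mapping.keys f \<subseteq> I \<rightarrow>\<^sub>E UNIV}"
      using tp by (simp add: is_tensor_power_def)
    then show ?thesis
      unfolding linear_extension_def by (auto intro!: span_sum span_scale intro: span_base)
  qed
  then show ?thesis by blast
qed

text \<open>Membership in a subspace is propagated through the tensor positions one at a time.\<close>

lemma tensor_power_subspaceI:
  assumes tp: "is_tensor_power I s s' \<tau>" and I: "finite I"
    and S: "module.subspace s' S"
    and base: "\<And>u. u \<in> I \<rightarrow>\<^sub>E A \<Longrightarrow> \<tau> u \<in> S"
    and step: "\<And>u i x. u \<in> I \<rightarrow>\<^sub>E UNIV \<Longrightarrow> i \<in> I \<Longrightarrow> (\<And>a. a \<in> A \<Longrightarrow> \<tau> (u(i := a)) \<in> S) \<Longrightarrow>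
      \<tau> (u(i := x)) \<in> S"
  shows "v \<in> S"
proof -
  interpret vector_space s' using tp by (simp add: is_tensor_power_def)
  \<comment> \<open>\<open>J\<close> is the set of positions whose entry is still arbitrary; all
    other entries lie in \<open>A\<close>.\<close>
  have main: "\<tau> u \<in> S" if "J \<subseteq> I" "u \<in> I \<rightarrow>\<^sub>E UNIV" "\<And>i. i \<in> I - J \<Longrightarrow> u i \<in> A" for J u
    using finite_subset[OF \<open>J \<subseteq> I\<close> I] that
  proof (induction J arbitrary: u rule: finite_induct)
    case empty
    then have "u \<in> I \<rightarrow>\<^sub>E A" by (auto simp: PiE_iff)
    then show ?case by (rule base)
  next
    case (insert j J)
    have "\<tau> (u(j := a)) \<in> S" if "a \<in> A" for a
    proof (rule insert.IH)
      show "J \<subseteq> I" using insert.prems(1) by simp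
      show "u(j := a) \<in> I \<rightarrow>\<^sub>E UNIV" using insert.prems(1,2) by simp
      show "(u(j := a)) i \<in> A" if "i \<in> I - J" for i
        using insert.prems(3)[of i] that \<open>a \<in> A\<close> by simp
    qed
    then have "\<tau> (u(j := u j)) \<in> S"
      using step[of u j "u j"] insert.prems(1,2) by simp
    then show ?case by simp
  qed
  have "\<tau> u \<in> S" if "u \<in> I \<rightarrow>\<^sub>E UNIV" for u
    by (rule main[of I u]) (simp_all add: that)
  then have "\<tau> ` (I \<rightarrow>\<^sub>E UNIV) \<subseteq> S" by (rule image_subsetI)
  then show ?thesis
    using span_minimal[of "\<tau> ` (I \<rightarrow>\<^sub>E UNIV)" S] S tensor_power_span[OF tp] by auto
qed

section \<open>Vertex operator algebras\<close>

context vertex_operator_algebra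
begin

lemma prod_hom_left: "module_hom (vscale V) (vscale V) (\<lambda>u. vprod V u m v)"
  using prod_linear_left by (simp add: module_hom_iff_linear)

lemma prod_hom_right: "module_hom (vscale V) (vscale V) (vprod V u m)"
  using prod_linear_right by (simp add: module_hom_iff_linear)

text \<open>The case \<open>p = 0\<close> of the Jacobi identity, in which only one term is left on
  the left side.\<close>

lemma iterate_formula:
  "vprod V (vprod V u r v) q w =
     Sum_any (\<lambda>i::nat. vscale V ((-1) ^ i * (of_int r gchoose i))
       (vprod V u (r - int i) (vprod V v (q + int i) w))) -
     Sum_any (\<lambda>i::nat. vscale V ((-1) ^ i * ((-1) powi r) * (of_int r gchoose i))
       (vprod V v (q + r - int i) (vprod V u (int i) w)))"
proof -
  have "Sum_any (\<lambda>i::nat. vscale V (of_int 0 gchoose i)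
          (vprod V (vprod V u (r + int i) v) (0 + q - int i) w)) =
        (\<Sum>i\<in>{0::nat}. vscale V (of_int 0 gchoose i)
          (vprod V (vprod V u (r + int i) v) (0 + q - int i) w))"
    by (rule Sum_any.expand_superset) (auto simp: gbinomial_0_left)
  then show ?thesis
    using jacobi[of 0 u r v q w] by simp
qed

text \<open>The coefficients in the iterate formula are integers, so it suffices to let generators act.\<close>

lemma prod_preserves_subgroup:
  assumes Q: "module.subspace (\<lambda>k::int. vscale V (of_int k)) Q"
    and u: "\<And>m w. w \<in> Q \<Longrightarrow> vprod V u m w \<in> Q" and v: "\<And>m w. w \<in> Q \<Longrightarrow> vprod V v m w \<in> Q"
    and w: "w \<in> Q"
  shows "vprod V (vprod V u r v) q w \<in> Q"
proof -
  interpret Z: module "\<lambda>k::int. vscale V (of_int k)"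
    by (rule module_of_int) (rule vector_space_axioms)
  have scale: "vscale V a x \<in> Q" if "a \<in> \<int>" "x \<in> Q" for a x
    using Z.subspace_scale[OF Q that(2)] that(1) by (auto elim!: Ints_cases)
  have gch: "(of_int r gchoose i :: complex) \<in> \<int>" for i
    by (simp flip: of_int_gbinomial)
  \<comment> \<open>Although \<open>r\<close> may be negative, the power is still 1 or -1.\<close>
  have sgn: "((-1) powi r :: complex) \<in> \<int>"
    by (cases "even r") simp_all
  \<comment> \<open>No condition on the support is required: on an infinite one
    \<open>Sum_any\<close> takes the default value 0, which lies in \<open>Q\<close>.\<close>
  have Sum_any: "Sum_any f \<in> Q" if "\<And>i. f i \<in> Q" for f :: "nat \<Rightarrow> 'v"
    using that by (simp add: Sum_any.expand_set Z.subspace_sum[OF Q])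
  show ?thesis
    unfolding iterate_formula
    by (intro Z.subspace_diff[OF Q] Sum_any scale Ints_mult Ints_power gch sgn u v w) simp_all
qed

lemma weight_space_subspace: "subspace (weight_space V m)"
proof -
  have hom: "module_hom (vscale V) (vscale V) (Lop V 0)"
    using prod_hom_right[of "conformal V" 1] by (simp add: Lop_def[abs_def])
  show ?thesis
    by (simp add: subspace_def weight_space_def module_hom.add[OF hom] module_hom.scale[OF hom]
        module_hom.zero[OF hom] scale_right_distrib mult.commute)
qed

lemma weight_decomposition_unique:
  assumes f: "finite {m. f m \<noteq> 0}" "\<And>m. f m \<in> weight_space V m"
    and g: "finite {m. g m \<noteq> 0}" "\<And>m. g m \<in> weight_space V m"
    and eq: "Sum_any f = Sum_any g"
  shows "f = g"
proof -
  have "\<exists>!h. finite {m. h m \<noteq> 0} \<and> (\<forall>m. h m \<in> weight_space V m) \<and> Sum_any f = Sum_any h"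
    using grading unfolding is_coproduct_def by blast
  then obtain h where h: "\<And>h'. finite {m. h' m \<noteq> 0} \<Longrightarrow> (\<And>m. h' m \<in> weight_space V m) \<Longrightarrow>
      Sum_any f = Sum_any h' \<Longrightarrow> h' = h"
    by (elim ex1E) blast
  have "f = h" by (rule h) (use f in simp_all)
  moreover have "g = h" by (rule h) (use g eq in simp_all)
  ultimately show ?thesis by simp
qed

text \<open>A linear relation is sorted by weight. Its homogeneous parts add up to 0, so by
  uniqueness of the weight decomposition each of them vanishes and is a relation inside a single
  \<open>B m\<close>.\<close>

lemma independent_weight_union:
  assumes ind: "\<And>m. independent (B m)" and B: "\<And>m. B m \<subseteq> weight_space V m"
  shows "independent (\<Union>m. B m)"
proof
  assume "dependent (\<Union>m. B m)"
  then obtain t r v0 where t: "finite t" "t \<subseteq> (\<Union>m. B m)" and 0: "(\<Sum>v\<in>t. vscale V (r v) v) = 0"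
    and v0: "v0 \<in> t" "r v0 \<noteq> 0"
    unfolding dependent_explicit by blast
  have "\<forall>v\<in>t. \<exists>m. v \<in> B m" using t(2) by blast
  then obtain w where w: "\<And>v. v \<in> t \<Longrightarrow> v \<in> B (w v)" by metis
  define f where "f m = (\<Sum>v | v \<in> t \<and> w v = m. vscale V (r v) v)" for m
  have f_wt: "f m \<in> weight_space V m" for m
    unfolding f_def using w B by (intro subspace_sum[OF weight_space_subspace]
        subspace_scale[OF weight_space_subspace]) auto
  have supp: "{m. f m \<noteq> 0} \<subseteq> w ` t"
  proof
    fix m assume "m \<in> {m. f m \<noteq> 0}"
    then have "(\<Sum>v | v \<in> t \<and> w v = m. vscale V (r v) v) \<noteq> 0" by (simp add: f_def)
    then show "m \<in> w ` t" by (elim sum.not_neutral_contains_not_neutral) auto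
  qed
  have "Sum_any f = (\<Sum>m\<in>w ` t. f m)"
    using t(1) supp by (intro Sum_any.expand_superset) auto
  also have "\<dots> = (\<Sum>v\<in>t. vscale V (r v) v)"
    unfolding f_def using t(1) by (intro sum.group) auto
  finally have "Sum_any f = 0" using 0 by simp
  moreover have "finite {m. f m \<noteq> 0}" using supp t(1) finite_subset by blast
  ultimately have "f = (\<lambda>_. 0)"
    using subspace_0[OF weight_space_subspace] by (intro weight_decomposition_unique f_wt) simp_all
  then have "f (w v0) = 0" by simp
  moreover have "{v. v \<in> t \<and> w v = w v0} \<subseteq> B (w v0)"
    using w by force
  ultimately have "r v0 = 0"
    using independentD[OF ind[of "w v0"], of "{v. v \<in> t \<and> w v = w v0}" r v0] t(1) v0(1)
    by (simp add: f_def)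
  then show False using v0(2) by simp
qed

end

section \<open>Tensor powers of the simple Virasoro vertex operator algebra\<close>

locale virasoro_tensor_power =
  fixes I :: "'i set" and c :: complex and L :: "'a::ab_group_add vertex_data"
    and V :: "'b::ab_group_add vertex_data" and \<tau> :: "('i \<Rightarrow> 'a) \<Rightarrow> 'b"
  assumes finite_index: "finite I"
    and virasoro_factor: "is_virasoro_voa c L"
    and tensor_voa: "is_tensor_power_voa I c L V \<tau>"
begin

sublocale factor: vertex_operator_algebra L c
  using virasoro_factor by (simp add: is_virasoro_voa_def)

sublocale power: vertex_operator_algebra V "of_nat (card I) * c"
  using tensor_voa by (simp add: is_tensor_power_voa_def)

sublocale factor_mod: virasoro_module "vscale L" "Lop L" c
  by (rule factor.virasoro)

section \<open>Virasoro modes on the tensor power\<close>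

abbreviation vac :: "'i \<Rightarrow> 'a" where "vac \<equiv> \<lambda>i\<in>I. vacuum L"

text \<open>The index is shifted by one as in \<open>Lop\<close>, so that these operators are the
  Virasoro generators of the factor in position \<open>i\<close>.\<close>

definition factor_mode :: "'i \<Rightarrow> int \<Rightarrow> 'b \<Rightarrow> 'b" where
  "factor_mode i m = vprod V (conformal_at I L \<tau> i) (m + 1)"

definition signed_mode :: "'i set \<Rightarrow> int \<Rightarrow> 'b \<Rightarrow> 'b" where
  "signed_mode T m = vprod V (signed_conformal I L \<tau> T) (m + 1)"

lemma tensor_power: "is_tensor_power I (vscale L) (vscale V) \<tau>"
  using tensor_voa by (simp add: is_tensor_power_voa_def)

lemma tensor_hom:
  "u \<in> I \<rightarrow>\<^sub>E UNIV \<Longrightarrow> i \<in> I \<Longrightarrow> module_hom (vscale L) (vscale V) (\<lambda>x. \<tau> (u(i := x)))"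
  using tensor_power_multilinear[OF tensor_power]
  by (simp add: multilinear_on_def module_hom_iff_linear)

lemma vacuum_eq: "vacuum V = \<tau> vac"
  using tensor_voa by (simp add: is_tensor_power_voa_def)

lemma factor_mode_hom: "module_hom (vscale V) (vscale V) (factor_mode i m)"
  unfolding factor_mode_def by (rule power.prod_hom_right)

lemma signed_mode_hom: "module_hom (vscale V) (vscale V) (signed_mode T m)"
  unfolding signed_mode_def by (rule power.prod_hom_right)

lemmas factor_mode_simps =
  module_hom.add[OF factor_mode_hom] module_hom.scale[OF factor_mode_hom]
  module_hom.diff[OF factor_mode_hom] module_hom.zero[OF factor_mode_hom]
  module_hom.sum[OF factor_mode_hom]

lemmas signed_mode_simps =
  module_hom.add[OF signed_mode_hom] module_hom.scale[OF signed_mode_hom]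
  module_hom.diff[OF signed_mode_hom] module_hom.zero[OF signed_mode_hom]
  module_hom.sum[OF signed_mode_hom]

text \<open>In every position but \<open>i\<close> the vacuum acts, so only the index -1 contributes
  there, and it fixes the entry. The condition on the sum of the indices then leaves
  \<open>m + 1\<close> in position \<open>i\<close>.\<close>

lemma factor_mode_tensor:
  assumes v: "v \<in> I \<rightarrow>\<^sub>E UNIV" and i: "i \<in> I"
  shows "factor_mode i m (\<tau> v) = \<tau> (v(i := Lop L m (v i)))"
proof -
  define u where "u = (\<lambda>j\<in>I. vacuum L)(i := conformal L)"
  define k0 where "k0 = (\<lambda>j\<in>I. if j = i then m + 1 else - 1 :: int)"
  define g where "g k = (if k \<in> I \<rightarrow>\<^sub>E UNIV \<and> (\<Sum>i\<in>I. - k i - 1) = - (m + 1) - 1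
    then \<tau> (\<lambda>j\<in>I. vprod L (u j) (k j) (v j)) else 0)" for k
  have u: "u \<in> I \<rightarrow>\<^sub>E UNIV" using i by (simp add: u_def)
  have "factor_mode i m (\<tau> v) = Sum_any g"
    using tensor_voa u v
    unfolding is_tensor_power_voa_def factor_mode_def conformal_at_def g_def u_def by blast
  also have "\<dots> = sum g {k0}"
  proof (rule Sum_any.expand_superset)
    show "{k. g k \<noteq> 0} \<subseteq> {k0}"
    proof (rule subsetI, rule ccontr)
      fix k assume "k \<in> {k. g k \<noteq> 0}" and "k \<notin> {k0}"
      then have k: "k \<in> I \<rightarrow>\<^sub>E UNIV" "(\<Sum>i\<in>I. - k i - 1) = - (m + 1) - 1"
        and nz: "\<tau> (\<lambda>j\<in>I. vprod L (u j) (k j) (v j)) \<noteq> 0" and "k \<noteq> k0"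
        by (auto simp: g_def split: if_splits)
      have "\<exists>j\<in>I. j \<noteq> i \<and> k j \<noteq> -1"
      proof (rule ccontr)
        assume neg: "\<not> ?thesis"
        then have "(\<Sum>j\<in>I - {i}. - k j - 1) = 0"
          by (intro sum.neutral) auto
        then have "(\<Sum>j\<in>I. - k j - 1) = - k i - 1"
          using finite_index i by (simp add: sum.remove)
        then have "k i = m + 1" using k(2) by simp
        then have "k = k0"
          using neg k(1) by (auto simp: k0_def fun_eq_iff PiE_def extensional_def)
        then show False using \<open>k \<noteq> k0\<close> by simp
      qed
      then obtain j where j: "j \<in> I" "j \<noteq> i" "k j \<noteq> -1" by blast
      let ?w = "\<lambda>j\<in>I. vprod L (u j) (k j) (v j)"
      have "?w j = 0" using j by (simp add: u_def factor.vacuum_left)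
      then have "?w = ?w(j := 0)" by (simp add: fun_upd_idem)
      moreover have "\<tau> (?w(j := 0)) = 0"
        using module_hom.zero[OF tensor_hom[of ?w j]] j(1) by simp
      ultimately show False using nz by simp
    qed
  qed simp
  also have "sum g {k0} = g k0" by simp
  also have "\<dots> = \<tau> (\<lambda>j\<in>I. vprod L (u j) (k0 j) (v j))"
  proof -
    have "(\<Sum>j\<in>I. - k0 j - 1) = - (m + 1) - 1"
      using finite_index i by (subst sum.remove[of I i]) (auto simp: k0_def)
    moreover have "k0 \<in> I \<rightarrow>\<^sub>E UNIV" by (simp add: k0_def)
    ultimately show ?thesis by (simp add: g_def)
  qed
  also have "(\<lambda>j\<in>I. vprod L (u j) (k0 j) (v j)) = v(i := Lop L m (v i))"
    using v i by (auto simp: fun_eq_iff u_def k0_def Lop_def factor.vacuum_left PiE_def extensional_def)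
  finally show ?thesis .
qed

lemma hom_eqI:
  assumes "module_hom (vscale V) s f" "module_hom (vscale V) s g"
    and "\<And>u. u \<in> I \<rightarrow>\<^sub>E UNIV \<Longrightarrow> f (\<tau> u) = g (\<tau> u)"
  shows "f v = g v"
proof -
  have "module_pair (vscale V) s"
    using assms(1) by (simp add: module_pair_def module_hom_iff)
  then show ?thesis
    using tensor_power_span[OF tensor_power] assms(3)
      module_pair.module_hom_eq_on_span[OF _ assms(1,2), of "\<tau> ` (I \<rightarrow>\<^sub>E UNIV)" v] by auto
qed

text \<open>Checked on pure tensors: operators acting in different positions commute, and within one
  position the bracket is that of the factor, with its own central charge \<open>c\<close>.\<close>

lemma factor_mode_bracket:
  assumes i: "i \<in> I" and j: "j \<in> I"
  shows "factor_mode i m (factor_mode j p v) - factor_mode j p (factor_mode i m v) =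
    (if i = j then vscale V (of_int (m - p)) (factor_mode i (m + p) v) +
       (if m + p = 0 then vscale V (of_int (m ^ 3 - m) / 12 * c) v else 0) else 0)"
proof (rule hom_eqI[where s = "vscale V" and v = v
      and f = "\<lambda>v. factor_mode i m (factor_mode j p v) - factor_mode j p (factor_mode i m v)"
      and g = "\<lambda>v. if i = j then vscale V (of_int (m - p)) (factor_mode i (m + p) v) +
       (if m + p = 0 then vscale V (of_int (m ^ 3 - m) / 12 * c) v else 0) else 0"])
  show "module_hom (vscale V) (vscale V)
      (\<lambda>v. factor_mode i m (factor_mode j p v) - factor_mode j p (factor_mode i m v))"
    unfolding module_hom_iff
    by (auto simp: factor_mode_simps power.scale_right_diff_distrib power.module_axioms)
  show "module_hom (vscale V) (vscale V)
      (\<lambda>v. if i = j then vscale V (of_int (m - p)) (factor_mode i (m + p) v) +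
       (if m + p = 0 then vscale V (of_int (m ^ 3 - m) / 12 * c) v else 0) else 0)"
    unfolding module_hom_iff
    by (auto simp: factor_mode_simps power.scale_right_distrib power.module_axioms mult.commute)
next
  fix u assume u: "u \<in> I \<rightarrow>\<^sub>E (UNIV :: 'a set)"
  show "factor_mode i m (factor_mode j p (\<tau> u)) - factor_mode j p (factor_mode i m (\<tau> u)) =
    (if i = j then vscale V (of_int (m - p)) (factor_mode i (m + p) (\<tau> u)) +
       (if m + p = 0 then vscale V (of_int (m ^ 3 - m) / 12 * c) (\<tau> u) else 0) else 0)"
  proof (cases "i = j")
    case False
    then show ?thesis
      using u i j by (simp add: factor_mode_tensor fun_upd_twist)
  next
    case True
    note hom = tensor_hom[OF u i]
    have "\<tau> (u(i := Lop L m (Lop L p (u i)))) - \<tau> (u(i := Lop L p (Lop L m (u i)))) =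
        \<tau> (u(i := Lop L m (Lop L p (u i)) - Lop L p (Lop L m (u i))))"
      by (simp add: module_hom.diff[OF hom])
    also have "\<dots> = vscale V (of_int (m - p)) (\<tau> (u(i := Lop L (m + p) (u i)))) +
       (if m + p = 0 then vscale V (of_int (m ^ 3 - m) / 12 * c) (\<tau> (u(i := u i))) else 0)"
      unfolding factor_mod.L_bracket
      by (simp add: module_hom.add[OF hom] module_hom.scale[OF hom] module_hom.zero[OF hom]
          del: fun_upd_triv)
    finally show ?thesis
      using u i True by (simp add: factor_mode_tensor)
  qed
qed

abbreviation sign :: "'i set \<Rightarrow> 'i \<Rightarrow> complex" where
  "sign T i \<equiv> if i \<in> T then -1 else 1"

lemma signed_conformal_eq:
  assumes "T \<subseteq> I"
  shows "signed_conformal I L \<tau> T = (\<Sum>i\<in>I. vscale V (sign T i) (conformal_at I L \<tau> i))"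
proof -
  have "(\<Sum>i\<in>I. vscale V (sign T i) (conformal_at I L \<tau> i)) =
      (\<Sum>i\<in>I - T. vscale V (sign T i) (conformal_at I L \<tau> i)) +
      (\<Sum>i\<in>T. vscale V (sign T i) (conformal_at I L \<tau> i))"
    using assms finite_index by (rule sum.subset_diff)
  then show ?thesis
    by (simp add: signed_conformal_def sum_negf)
qed

lemma signed_mode_eq:
  assumes "T \<subseteq> I"
  shows "signed_mode T m v = (\<Sum>i\<in>I. vscale V (sign T i) (factor_mode i m v))"
  unfolding signed_mode_def factor_mode_def signed_conformal_eq[OF assms]
  by (simp only: module_hom.sum[OF power.prod_hom_left] module_hom.scale[OF power.prod_hom_left])

lemma sum_sign:
  assumes "T \<subseteq> I"
  shows "(\<Sum>i\<in>I. sign T i) = of_nat (card I) - 2 * of_nat (card T)"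
proof -
  have "(\<Sum>i\<in>I. sign T i) = (\<Sum>i\<in>I - T. sign T i) + (\<Sum>i\<in>T. sign T i)"
    using assms finite_index by (rule sum.subset_diff)
  also have "\<dots> = of_nat (card (I - T)) - of_nat (card T)"
    by simp
  also have "of_nat (card (I - T)) = (of_nat (card I) - of_nat (card T) :: complex)"
    using assms finite_index by (simp add: card_Diff_subset finite_subset card_mono of_nat_diff)
  finally show ?thesis by simp
qed

text \<open>Only the diagonal terms of the double sum survive. There the two signs multiply to the
  sign of the symmetric difference, and the sum of these signs over \<open>I\<close> scales the
  central term.\<close>

lemma signed_mode_bracket:
  assumes S: "S \<subseteq> I" and T: "T \<subseteq> I"
  shows "signed_mode T m (signed_mode S p v) - signed_mode S p (signed_mode T m v) =
    vscale V (of_int (m - p)) (signed_mode (sym_diff T S) (m + p) v) +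
    (if m + p = 0 then vscale V (of_int (m ^ 3 - m) / 12 * c *
       (of_nat (card I) - 2 * of_nat (card (sym_diff T S)))) v else 0)"
proof -
  have sub: "sym_diff T S \<subseteq> I" using S T by blast
  have sgn: "sign T i * sign S i = sign (sym_diff T S) i" for i by auto
  let ?z = "if m + p = 0 then vscale V (of_int (m ^ 3 - m) / 12 * c) v else 0"
  have 1: "signed_mode T m (signed_mode S p v) =
      (\<Sum>i\<in>I. \<Sum>j\<in>I. vscale V (sign T i * sign S j) (factor_mode i m (factor_mode j p v)))"
    by (simp only: signed_mode_eq[OF S] signed_mode_eq[OF T] factor_mode_simps
        power.scale_sum_right power.scale_scale)
  have 2: "signed_mode S p (signed_mode T m v) =
      (\<Sum>i\<in>I. \<Sum>j\<in>I. vscale V (sign T i * sign S j) (factor_mode j p (factor_mode i m v)))"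
    by (subst sum.swap)
      (simp only: signed_mode_eq[OF S] signed_mode_eq[OF T] factor_mode_simps
        power.scale_sum_right power.scale_scale mult.commute)
  have "signed_mode T m (signed_mode S p v) - signed_mode S p (signed_mode T m v) =
      (\<Sum>i\<in>I. \<Sum>j\<in>I. vscale V (sign T i * sign S j)
        (factor_mode i m (factor_mode j p v) - factor_mode j p (factor_mode i m v)))"
    by (simp only: 1 2 power.scale_right_diff_distrib sum_subtractf)
  also have "\<dots> = (\<Sum>i\<in>I. \<Sum>j\<in>I. if i = j then vscale V (sign T i * sign S i)
        (vscale V (of_int (m - p)) (factor_mode i (m + p) v) + ?z) else 0)"
    by (intro sum.cong refl) (auto simp: factor_mode_bracket)
  also have "\<dots> = (\<Sum>i\<in>I. vscale V (sign (sym_diff T S) i)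
        (vscale V (of_int (m - p)) (factor_mode i (m + p) v) + ?z))"
    using finite_index by (simp only: sum.delta' sum.delta if_True sgn cong: sum.cong)
  also have "\<dots> = vscale V (of_int (m - p)) (signed_mode (sym_diff T S) (m + p) v) +
      vscale V (\<Sum>i\<in>I. sign (sym_diff T S) i) ?z"
    by (simp only: signed_mode_eq[OF sub] power.scale_right_distrib sum.distrib
        power.scale_sum_right power.scale_sum_left power.scale_left_commute)
  also have "vscale V (\<Sum>i\<in>I. sign (sym_diff T S) i) ?z =
      (if m + p = 0 then vscale V (of_int (m ^ 3 - m) / 12 * c *
       (of_nat (card I) - 2 * of_nat (card (sym_diff T S)))) v else 0)"
    by (simp only: sum_sign[OF sub]) (simp add: mult.commute)
  finally show ?thesis .
qed

lemma signed_mode_vacuum: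
  "m \<ge> -1 \<Longrightarrow> signed_mode T m (vacuum V) = 0"
  by (simp add: signed_mode_def power.creation)

lemma conformal_eq_signed: "conformal V = signed_conformal I L \<tau> {}"
  using tensor_voa by (simp add: is_tensor_power_voa_def signed_conformal_def)

lemma Lop_eq_signed_mode: "Lop V m = signed_mode {} m"
  by (simp add: fun_eq_iff Lop_def signed_mode_def conformal_eq_signed)

section \<open>Functionals and contractions on the tensor power\<close>

lemma linear_functional_prod:
  assumes A: "finite A" and \<phi>: "\<And>k. k \<in> A \<Longrightarrow> Vector_Spaces.linear (vscale L) (*) (\<phi> k)"
    and i: "i \<in> A"
  shows "Vector_Spaces.linear (vscale L) (*) (\<lambda>x. \<Prod>k\<in>A. \<phi> k ((u(i := x)) k))"
proof -
  have hom: "module_hom (vscale L) (*) (\<phi> i)"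
    using \<phi>[OF i] by (simp add: module_hom_iff_linear)
  have "(\<Prod>k\<in>A. \<phi> k ((u(i := x)) k)) = \<phi> i x * (\<Prod>k\<in>A - {i}. \<phi> k (u k))" for x
    using A i by (simp add: prod.remove)
  then show ?thesis
    using hom by (simp add: module_hom_iff_linear[symmetric] module_hom_iff algebra_simps)
qed

lemma tensor_functional_exists:
  assumes "\<And>i. i \<in> I \<Longrightarrow> Vector_Spaces.linear (vscale L) (*) (\<phi> i)"
  shows "\<exists>G. Vector_Spaces.linear (vscale V) (*) G \<and>
    (\<forall>u \<in> I \<rightarrow>\<^sub>E UNIV. G (\<tau> u) = (\<Prod>i\<in>I. \<phi> i (u i)))"
proof -
  have "multilinear_on I (vscale L) (*) (\<lambda>u. \<Prod>i\<in>I. \<phi> i (u i))"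
    unfolding multilinear_on_def
    by (intro ballI linear_functional_prod[where \<phi> = \<phi>] finite_index assms)
  moreover have "vector_space ((*) :: complex \<Rightarrow> complex \<Rightarrow> complex)"
    by unfold_locales (simp_all add: algebra_simps)
  ultimately show ?thesis
    by (rule tensor_power_lift[OF tensor_power])
qed

text \<open>The tensor product of linear functionals; for these the choice is unique because pure
  tensors span.\<close>

definition tensor_functional :: "('i \<Rightarrow> 'a \<Rightarrow> complex) \<Rightarrow> 'b \<Rightarrow> complex" where
  "tensor_functional \<phi> = (SOME G. Vector_Spaces.linear (vscale V) (*) G \<and>
    (\<forall>u \<in> I \<rightarrow>\<^sub>E UNIV. G (\<tau> u) = (\<Prod>i\<in>I. \<phi> i (u i))))"

lemma
  assumes "\<And>i. i \<in> I \<Longrightarrow> Vector_Spaces.linear (vscale L) (*) (\<phi> i)"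
  shows tensor_functional_hom: "module_hom (vscale V) (*) (tensor_functional \<phi>)"
    and tensor_functional_tensor:
      "u \<in> I \<rightarrow>\<^sub>E UNIV \<Longrightarrow> tensor_functional \<phi> (\<tau> u) = (\<Prod>i\<in>I. \<phi> i (u i))"
  using someI_ex[OF tensor_functional_exists[OF assms]]
  by (simp_all add: tensor_functional_def module_hom_iff_linear)

text \<open>Expand \<open>v\<close> in tensors of basis vectors of the factor; products of
  coordinate functionals read off the coefficients one at a time.\<close>

lemma tensor_functionals_separate:
  assumes zero: "\<And>\<phi>. (\<And>i. i \<in> I \<Longrightarrow> Vector_Spaces.linear (vscale L) (*) (\<phi> i)) \<Longrightarrow>
    tensor_functional \<phi> v = 0"
  shows "v = 0"
proof -
  define B where "B = factor.extend_basis {}"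
  have B: "factor.independent B" "factor.span B = UNIV"
    unfolding B_def
    by (rule factor.independent_extend_basis factor.span_extend_basis, rule factor.independent_empty)+
  have "v \<in> power.span (\<tau> ` (I \<rightarrow>\<^sub>E B))"
  proof (rule tensor_power_subspaceI[OF tensor_power finite_index power.subspace_span])
    show "\<tau> u \<in> power.span (\<tau> ` (I \<rightarrow>\<^sub>E B))" if "u \<in> I \<rightarrow>\<^sub>E B" for u
      using that by (intro power.span_base imageI)
  next
    fix u :: "'i \<Rightarrow> 'a" and i x
    assume u: "u \<in> I \<rightarrow>\<^sub>E UNIV" "i \<in> I"
      and *: "\<And>a. a \<in> B \<Longrightarrow> \<tau> (u(i := a)) \<in> power.span (\<tau> ` (I \<rightarrow>\<^sub>E B))"
    have "factor.subspace ((\<lambda>x. \<tau> (u(i := x))) -` power.span (\<tau> ` (I \<rightarrow>\<^sub>E B)))"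
      by (rule module_hom.subspace_vimage[OF tensor_hom[OF u]]) (rule power.subspace_span)
    then have "factor.span B \<subseteq> (\<lambda>x. \<tau> (u(i := x))) -` power.span (\<tau> ` (I \<rightarrow>\<^sub>E B))"
      using * by (intro factor.span_minimal) auto
    then show "\<tau> (u(i := x)) \<in> power.span (\<tau> ` (I \<rightarrow>\<^sub>E B))"
      using B(2) by auto
  qed
  then obtain t r where t: "finite t" "t \<subseteq> \<tau> ` (I \<rightarrow>\<^sub>E B)" and v: "v = (\<Sum>x\<in>t. vscale V (r x) x)"
    unfolding power.span_explicit by blast
  from t(2) obtain U where U: "U \<subseteq> I \<rightarrow>\<^sub>E B" "inj_on \<tau> U" "t = \<tau> ` U"
    by (auto simp: subset_image_inj)
  have "finite U" using t(1) U(2,3) by (simp add: finite_image_iff)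
  have v': "v = (\<Sum>b\<in>U. vscale V (r (\<tau> b)) (\<tau> b))"
    using U by (simp add: v sum.reindex)
  have "r (\<tau> b0) = 0" if b0: "b0 \<in> U" for b0
  proof -
    \<comment> \<open>The coordinate functionals dual to the entries of \<open>b0\<close>; their
      tensor product is 1 at \<open>b0\<close> and 0 at the other families in
      \<open>U\<close>.\<close>
    define \<phi> where "\<phi> i x = factor.representation B x (b0 i)" for i x
    have \<phi>: "Vector_Spaces.linear (vscale L) (*) (\<phi> i)" for i
      unfolding \<phi>_def using B by (intro factor.linear_representation)
    have \<phi>_basis: "\<phi> i (b i) = (if b i = b0 i then 1 else 0)" if "i \<in> I" "b \<in> U" for i b
    proof -
      have "b i \<in> B" using U(1) that by (auto simp: PiE_iff)
      then show ?thesis unfolding \<phi>_def using factor.representation_basis[OF B(1)] by auto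
    qed
    have "tensor_functional \<phi> (\<tau> b) = (if b = b0 then 1 else 0)" if b: "b \<in> U" for b
    proof -
      have bE: "b \<in> I \<rightarrow>\<^sub>E UNIV" "b0 \<in> I \<rightarrow>\<^sub>E UNIV" using U(1) b b0 by (auto simp: PiE_iff)
      have "tensor_functional \<phi> (\<tau> b) = (\<Prod>i\<in>I. if b i = b0 i then 1 else 0)"
        unfolding tensor_functional_tensor[OF \<phi> bE(1)] using \<phi>_basis b by (intro prod.cong) auto
      moreover have "b = b0" if "\<forall>i\<in>I. b i = b0 i"
        using bE that by (intro PiE_ext) auto
      ultimately show ?thesis
        using finite_index by (auto simp: prod_zero_iff)
    qed
    then have "tensor_functional \<phi> v = (\<Sum>b\<in>U. r (\<tau> b) * (if b = b0 then 1 else 0))"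
      by (simp add: v' module_hom.sum[OF tensor_functional_hom[OF \<phi>]]
          module_hom.scale[OF tensor_functional_hom[OF \<phi>]] cong: sum.cong)
    also have "\<dots> = r (\<tau> b0)"
      using \<open>finite U\<close> b0 by (simp add: if_distrib[of "(*) _"] cong: if_cong)
    finally show ?thesis using zero[OF \<phi>] by simp
  qed
  then show ?thesis by (simp add: v')
qed

text \<open>Evaluating functionals in all positions except \<open>j\<close> leads back from the
  tensor power to a single factor, where irreducibility can be used.\<close>

lemma contraction_exists:
  assumes j: "j \<in> I" and \<phi>: "\<And>i. i \<in> I \<Longrightarrow> Vector_Spaces.linear (vscale L) (*) (\<phi> i)"
  obtains \<pi> where "module_hom (vscale V) (vscale L) \<pi>"
    "\<And>u. u \<in> I \<rightarrow>\<^sub>E UNIV \<Longrightarrow> \<pi> (\<tau> u) = vscale L (\<Prod>i\<in>I - {j}. \<phi> i (u i)) (u j)"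
proof -
  let ?F = "\<lambda>u. vscale L (\<Prod>i\<in>I - {j}. \<phi> i (u i)) (u j)"
  have "multilinear_on I (vscale L) (vscale L) ?F"
    unfolding multilinear_on_def
  proof (intro ballI)
    fix u :: "'i \<Rightarrow> 'a" and i assume u: "u \<in> I \<rightarrow>\<^sub>E UNIV" and i: "i \<in> I"
    show "Vector_Spaces.linear (vscale L) (vscale L) (\<lambda>x. ?F (u(i := x)))"
    proof (cases "i = j")
      case True
      then have eq: "(\<lambda>x. ?F (u(i := x))) = vscale L (\<Prod>i\<in>I - {j}. \<phi> i (u i))"
        by (auto intro!: ext arg_cong2[where f = "vscale L"] prod.cong)
      show ?thesis
        unfolding eq by (rule factor.module_hom_scale_self)
    next
      case False
      then have "Vector_Spaces.linear (vscale L) (*) (\<lambda>x. \<Prod>k\<in>I - {j}. \<phi> k ((u(i := x)) k))"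
        using finite_index i \<phi> by (intro linear_functional_prod) auto
      then show ?thesis
        using False unfolding module_hom_iff_linear[symmetric] module_hom_iff
        by (simp add: factor.scale_left_distrib)
    qed
  qed
  from tensor_power_lift[OF tensor_power this factor.vector_space_axioms]
  show thesis
    using that by (auto simp: module_hom_iff_linear)
qed

section \<open>Irreducibility and generation by the vacuum, transferred from the factors\<close>

lemma factor_irreducible:
  "factor_mod.submodule W \<Longrightarrow> W = {0} \<or> W = UNIV"
  using virasoro_factor
  by (simp add: is_virasoro_voa_def is_virasoro_L_def factor_mod.irreducible_module_def)

lemma factor_lowest_weight: "factor_mod.lowest_weight_module 0 (vacuum L)"
  using virasoro_factor by (simp add: is_virasoro_voa_def is_virasoro_L_def)

text \<open>To be applied to the common kernel of the integral functionals. The vector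
  \<open>x\<close> witnesses that \<open>\<epsilon>\<close> is nonzero, which makes the contractions
  of \<open>U\<close> proper submodules.\<close>

lemma invariant_subspace_trivial:
  assumes U: "power.subspace U"
    and inv: "\<And>i m v. i \<in> I \<Longrightarrow> v \<in> U \<Longrightarrow> factor_mode i m v \<in> U"
    and \<epsilon>: "Vector_Spaces.linear (vscale L) (*) \<epsilon>" "\<epsilon> x \<noteq> 0"
    and zero: "\<And>v. v \<in> U \<Longrightarrow> tensor_functional (\<lambda>_. \<epsilon>) v = 0"
    and v: "v \<in> U"
  shows "v = 0"
proof -
  text \<open>The functional \<open>\<epsilon>\<close> is replaced by arbitrary functionals in one position after the other:
    contracting \<open>U\<close> in all other positions gives a submodule of the irreducible factor.\<close>
  have main: "tensor_functional \<phi> v = 0"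
    if "J \<subseteq> I" "\<And>i. i \<in> I \<Longrightarrow> Vector_Spaces.linear (vscale L) (*) (\<phi> i)"
      "\<And>i. i \<in> I - J \<Longrightarrow> \<phi> i = \<epsilon>" "v \<in> U" for J \<phi> v
    using finite_subset[OF that(1) finite_index] that
  proof (induction J arbitrary: \<phi> v rule: finite_induct)
    case empty
    have "tensor_functional \<phi> v = tensor_functional (\<lambda>_. \<epsilon>) v"
    proof (rule hom_eqI[where s = "(*)" and v = v])
      show "tensor_functional \<phi> (\<tau> u) = tensor_functional (\<lambda>_. \<epsilon>) (\<tau> u)"
        if "u \<in> I \<rightarrow>\<^sub>E UNIV" for u
        using that empty.prems(2,3) \<epsilon>(1) by (simp add: tensor_functional_tensor)
    qed (use empty.prems(2) \<epsilon>(1) in \<open>simp_all add: tensor_functional_hom\<close>)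
    then show ?case using zero empty.prems(4) by simp
  next
    case (insert j J)
    then have j: "j \<in> I" by simp
    obtain \<pi> where \<pi>: "module_hom (vscale V) (vscale L) \<pi>"
      and \<pi>_tensor: "\<And>u. u \<in> I \<rightarrow>\<^sub>E UNIV \<Longrightarrow> \<pi> (\<tau> u) = vscale L (\<Prod>i\<in>I - {j}. \<phi> i (u i)) (u j)"
      using contraction_exists[where \<phi> = \<phi>, OF j insert.prems(2)] by blast
    have comp: "\<psi> (\<pi> w) = tensor_functional (\<phi>(j := \<psi>)) w"
      if \<psi>: "Vector_Spaces.linear (vscale L) (*) \<psi>" for \<psi> w
    proof (rule hom_eqI[where s = "(*)" and f = "\<lambda>w. \<psi> (\<pi> w)" and v = w])
      have hom: "module_hom (vscale L) (*) \<psi>" using \<psi> by (simp add: module_hom_iff_linear)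
      show "module_hom (vscale V) (*) (\<lambda>w. \<psi> (\<pi> w))"
        using module_hom_compose[OF \<pi> hom] by (simp add: comp_def)
      have lin: "Vector_Spaces.linear (vscale L) (*) ((\<phi>(j := \<psi>)) i)" if "i \<in> I" for i
        using \<psi> insert.prems(2) that by simp
      show "module_hom (vscale V) (*) (tensor_functional (\<phi>(j := \<psi>)))"
        by (rule tensor_functional_hom[where \<phi> = "\<phi>(j := \<psi>)", OF lin])
      show "\<psi> (\<pi> (\<tau> u)) = tensor_functional (\<phi>(j := \<psi>)) (\<tau> u)" if "u \<in> I \<rightarrow>\<^sub>E UNIV" for u
      proof -
        have "tensor_functional (\<phi>(j := \<psi>)) (\<tau> u) = (\<Prod>i\<in>I. (\<phi>(j := \<psi>)) i (u i))"
          by (rule tensor_functional_tensor) (use lin that in auto)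
        then show ?thesis
          using finite_index j
          by (simp add: \<pi>_tensor[OF that] module_hom.scale[OF hom] prod.remove)
      qed
    qed
    \<comment> \<open>The mode acts in position \<open>j\<close>, the one position in which
      \<open>\<pi>\<close> evaluates no functional, so \<open>\<pi>\<close> intertwines it with the
      action on the factor.\<close>
    have mode: "Lop L m (\<pi> w) = \<pi> (factor_mode j m w)" for m w
    proof (rule hom_eqI[where s = "vscale L" and f = "\<lambda>w. Lop L m (\<pi> w)"
        and g = "\<lambda>w. \<pi> (factor_mode j m w)" and v = w])
      have "module_hom (vscale L) (vscale L) (Lop L m)"
        using factor_mod.L_linear by (simp add: module_hom_iff_linear)
      note hom = this
      show "module_hom (vscale V) (vscale L) (\<lambda>w. Lop L m (\<pi> w))"
        using module_hom_compose[OF \<pi> hom] by (simp add: comp_def)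
      show "module_hom (vscale V) (vscale L) (\<lambda>w. \<pi> (factor_mode j m w))"
        using module_hom_compose[OF factor_mode_hom \<pi>] by (simp add: comp_def)
      show "Lop L m (\<pi> (\<tau> u)) = \<pi> (factor_mode j m (\<tau> u))" if "u \<in> I \<rightarrow>\<^sub>E UNIV" for u
      proof -
        have "(\<Prod>i\<in>I - {j}. \<phi> i ((u(j := y)) i)) = (\<Prod>i\<in>I - {j}. \<phi> i (u i))" for y
          by (rule prod.cong) auto
        then show ?thesis
          using that j by (simp add: \<pi>_tensor factor_mode_tensor module_hom.scale[OF hom]
              fun_upd_same del: fun_upd_apply)
      qed
    qed
    have "factor_mod.submodule (\<pi> ` U)"
      unfolding factor_mod.submodule_def
      using module_hom.subspace_image[OF \<pi> U] mode inv[OF j] by auto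
    \<comment> \<open>With \<open>\<epsilon>\<close> put back into position \<open>j\<close>,
      arbitrary functionals remain only in \<open>J\<close>, so the induction hypothesis
      applies.\<close>
    moreover have "\<epsilon> (\<pi> w) = 0" if "w \<in> U" for w
      unfolding comp[OF \<epsilon>(1)] using insert.prems insert.hyps \<epsilon>(1) that
      by (intro insert.IH) auto
    then have "x \<notin> \<pi> ` U" using \<epsilon>(2) by auto
    ultimately have "\<pi> ` U = {0}"
      using factor_irreducible by blast
    then have "\<pi> v = 0" using insert.prems(4) by blast
    then have "\<phi> j (\<pi> v) = 0"
      using insert.prems(2)[OF j] by (simp add: module_hom_iff_linear[symmetric] module_hom.zero)
    then show ?case
      using comp[OF insert.prems(2)[OF j]] by simp
  qed
  show ?thesis
    by (rule tensor_functionals_separate) (use main[of I] v in simp)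
qed

text \<open>The vacuum generates the factor as a Virasoro module, so, starting from the vacuum
  tensor, one entry after the other can be made arbitrary without leaving \<open>S\<close>.\<close>

lemma tensor_eq_spanI:
  assumes S: "power.subspace S" and vac: "vacuum V \<in> S"
    and inv: "\<And>i m v. i \<in> I \<Longrightarrow> v \<in> S \<Longrightarrow> factor_mode i m v \<in> S"
  shows "v \<in> S"
proof (rule tensor_power_subspaceI[OF tensor_power finite_index S])
  show "\<tau> u \<in> S" if "u \<in> I \<rightarrow>\<^sub>E {vacuum L}" for u
  proof -
    have "u = vac" using that by (auto simp: fun_eq_iff PiE_iff extensional_def)
    then show ?thesis using vac by (simp add: vacuum_eq)
  qed
next
  fix u :: "'i \<Rightarrow> 'a" and i x
  assume u: "u \<in> I \<rightarrow>\<^sub>E UNIV" "i \<in> I" and *: "\<And>a. a \<in> {vacuum L} \<Longrightarrow> \<tau> (u(i := a)) \<in> S"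
  \<comment> \<open>The entries allowed in position \<open>i\<close> form a Virasoro submodule
    containing the vacuum.\<close>
  let ?W = "(\<lambda>x. \<tau> (u(i := x))) -` S"
  have "factor.subspace ?W"
    by (rule module_hom.subspace_vimage[OF tensor_hom[OF u]]) (rule S)
  moreover have "Lop L m x \<in> ?W" if "x \<in> ?W" for m x
  proof -
    have "factor_mode i m (\<tau> (u(i := x))) \<in> S" using that u(2) by (intro inv) auto
    then show ?thesis using u by (simp add: factor_mode_tensor)
  qed
  ultimately have "factor_mod.submodule ?W" by (simp add: factor_mod.submodule_def)
  then have "?W = UNIV"
    using factor_lowest_weight * by (auto simp: factor_mod.lowest_weight_module_def)
  then show "\<tau> (u(i := x)) \<in> S" by blast
qed

text \<open>\<open>L(0)\<close> annihilates weight 0, so the nonzero vacuum is outside its image,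
  and a functional can be prescribed to be 0 on the image and 1 at the vacuum.\<close>

lemma vacuum_functional_exists:
  obtains \<epsilon> where "Vector_Spaces.linear (vscale L) (*) \<epsilon>" "\<epsilon> (vacuum L) = 1"
    "\<And>x. \<epsilon> (Lop L 0 x) = 0"
proof -
  have lw: "vacuum L \<noteq> 0" "Lop L 0 (vacuum L) = 0"
    using factor_lowest_weight by (simp_all add: factor_mod.lowest_weight_module_def)
  have hom: "module_hom (vscale L) (vscale L) (Lop L 0)"
    using factor_mod.L_linear by (simp add: module_hom_iff_linear)
  have not_range: "vacuum L \<notin> range (Lop L 0)"
  proof
    assume "vacuum L \<in> range (Lop L 0)"
    then obtain x where x: "vacuum L = Lop L 0 x" by blast
    obtain f where f: "finite {m. f m \<noteq> 0}" "\<And>m. f m \<in> weight_space L m" "x = Sum_any f"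
      using factor.grading unfolding is_coproduct_def by blast
    \<comment> \<open>The weight components of \<open>L(0) x\<close>. The component of weight 0 is
      multiplied by 0, whereas the vacuum is concentrated in weight 0.\<close>
    define g where "g m = vscale L (of_int m) (f m)" for m
    have "vacuum L = (\<Sum>m | f m \<noteq> 0. g m)"
      using f(2) by (simp add: x f(3) Sum_any.expand_set module_hom.sum[OF hom] weight_space_def g_def)
    also have "\<dots> = Sum_any g"
      by (rule Sum_any.expand_superset[symmetric]) (use f(1) in \<open>auto simp: g_def\<close>)
    finally have g: "vacuum L = Sum_any g" .
    have g_fin: "finite {m. g m \<noteq> 0}"
      by (rule finite_subset[OF _ f(1)]) (auto simp: g_def)
    have g_wt: "g m \<in> weight_space L m" for m
      using f(2)[of m] by (simp add: weight_space_def g_def module_hom.scale[OF hom])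
    define h where "h = (\<lambda>m::int. if m = 0 then vacuum L else 0)"
    have h: "vacuum L = Sum_any h" "finite {m. h m \<noteq> 0}"
      by (simp_all add: h_def Sum_any.expand_set cong: if_cong)
    have h_wt: "h m \<in> weight_space L m" for m
      using lw(2) by (simp add: weight_space_def h_def module_hom.zero[OF hom])
    have "g = h"
      using g h by (intro factor.weight_decomposition_unique g_fin g_wt h_wt) simp_all
    from fun_cong[OF this, of 0] show False using lw(1) by (simp add: g_def h_def)
  qed
  interpret P: vector_space_pair "vscale L" "(*) :: complex \<Rightarrow> complex \<Rightarrow> complex"
    by unfold_locales (simp_all add: algebra_simps)
  obtain B where B: "B \<subseteq> range (Lop L 0)" "factor.independent B" "range (Lop L 0) \<subseteq> factor.span B"
    using factor.maximal_independent_subset by blast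
  have "factor.subspace (range (Lop L 0))"
    by (rule module_hom.subspace_image[OF hom]) (rule factor.subspace_UNIV)
  then have "factor.span B \<subseteq> range (Lop L 0)"
    using B(1) by (intro factor.span_minimal)
  then have nB: "vacuum L \<notin> factor.span B" using not_range by blast
  then have "factor.independent (insert (vacuum L) B)"
    using B(2) by (intro factor.independent_insertI)
  then obtain \<epsilon> where \<epsilon>: "Vector_Spaces.linear (vscale L) (*) \<epsilon>"
    "\<And>x. x \<in> insert (vacuum L) B \<Longrightarrow> \<epsilon> x = (if x = vacuum L then 1 else 0)"
    using P.linear_independent_extend[of "insert (vacuum L) B" "\<lambda>x. if x = vacuum L then 1 else 0"]
    by blast
  have "\<epsilon> b = 0" if "b \<in> B" for b
    using \<epsilon>(2)[of b] that nB factor.span_base by auto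
  then have "\<epsilon> (Lop L 0 x) = 0" for x
    using module_hom.eq_0_on_span[of "vscale L" "(*)" \<epsilon> B "Lop L 0 x"] \<epsilon>(1) B(3)
    by (auto simp: module_hom_iff_linear)
  then show thesis
    using \<epsilon>(2)[of "vacuum L"] by (intro that[OF \<epsilon>(1)]) auto
qed

end

section \<open>The vertex subring of a code\<close>

text \<open>The integrality assumption, applied to the symmetric difference of \<open>S\<close> and
  \<open>T\<close>, says that the vacuum coefficient in \<open>L_T(2) L_S(-2) 1\<close> is an
  integer.\<close>

locale virasoro_code_generators = virasoro_tensor_power I c L V \<tau>
  for I :: "'i set" and c and L :: "'a::ab_group_add vertex_data"
    and V :: "'b::ab_group_add vertex_data" and \<tau> +
  fixes C :: "'i set set"
  assumes code: "binary_linear_code I C"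
    and central_charge_integral:
      "T \<in> C \<Longrightarrow> c / 2 * (of_nat (card I) - 2 * of_nat (card T)) \<in> \<int>"
    and separating: "i \<in> I \<Longrightarrow> j \<in> I \<Longrightarrow> i \<noteq> j \<Longrightarrow> \<exists>T\<in>C. i \<in> T \<and> j \<notin> T"
begin

section \<open>Fourier inversion over the code\<close>

lemma code_subset: "T \<in> C \<Longrightarrow> T \<subseteq> I"
  using code by (auto simp: binary_linear_code_def)

lemma empty_in_code: "{} \<in> C"
  using code by (simp add: binary_linear_code_def)

lemma sym_diff_in_code: "S \<in> C \<Longrightarrow> T \<in> C \<Longrightarrow> sym_diff S T \<in> C"
  using code by (simp add: binary_linear_code_def)

lemma finite_code: "finite C"
  using code finite_index finite_subset by (auto simp: binary_linear_code_def)

sublocale Z: module "\<lambda>k::int. vscale V (of_int k)"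
  by (rule module_of_int) (rule power.vector_space_axioms)

text \<open>Orthogonality: for distinct \<open>i\<close> and \<open>j\<close>, adding a codeword
  that separates them permutes \<open>C\<close> and reverses the sign of every term.\<close>

lemma sum_sign_product:
  assumes i: "i \<in> I" and j: "j \<in> I"
  shows "(\<Sum>T\<in>C. sign T i * sign T j) = (if i = j then of_nat (card C) else 0)"
proof (cases "i = j")
  case True
  have "(\<Sum>T\<in>C. sign T i * sign T j) = (\<Sum>T\<in>C. 1)"
    using True by (intro sum.cong) auto
  then show ?thesis using True by simp
next
  case False
  then obtain S where S: "S \<in> C" "i \<in> S" "j \<notin> S" using separating i j by blast
  have "(\<Sum>T\<in>C. sign T i * sign T j) = (\<Sum>T\<in>C. - (sign T i * sign T j))"
    by (rule sum.reindex_bij_witness[of C "\<lambda>T. sym_diff T S" "\<lambda>T. sym_diff T S"])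
      (use S sym_diff_in_code in auto)
  then show ?thesis using False by (simp add: sum_negf)
qed

text \<open>Fourier inversion. It costs the factor \<open>card C\<close>, which can be divided out
  in a complex subspace.\<close>

lemma factor_mode_combination:
  assumes i: "i \<in> I"
  shows "vscale V (of_nat (card C)) (factor_mode i m v) =
    (\<Sum>T\<in>C. vscale V (sign T i) (signed_mode T m v))"
proof -
  have "(\<Sum>T\<in>C. vscale V (sign T i) (signed_mode T m v)) =
      (\<Sum>T\<in>C. \<Sum>j\<in>I. vscale V (sign T i * sign T j) (factor_mode j m v))"
    by (intro sum.cong refl)
      (simp only: signed_mode_eq[OF code_subset] power.scale_sum_right power.scale_scale)
  also have "\<dots> = (\<Sum>j\<in>I. vscale V (\<Sum>T\<in>C. sign T i * sign T j) (factor_mode j m v))"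
    by (subst sum.swap) (simp only: power.scale_sum_left)
  also have "\<dots> = (\<Sum>j\<in>I. if i = j then vscale V (of_nat (card C)) (factor_mode i m v) else 0)"
    by (intro sum.cong refl) (simp only: sum_sign_product[OF i], simp)
  finally show ?thesis using i finite_index by simp
qed

lemma factor_mode_invariant:
  assumes S: "power.subspace S"
    and inv: "\<And>T m v. T \<in> C \<Longrightarrow> v \<in> S \<Longrightarrow> signed_mode T m v \<in> S"
    and "i \<in> I" "v \<in> S"
  shows "factor_mode i m v \<in> S"
proof -
  have nz: "(of_nat (card C) :: complex) \<noteq> 0"
    using finite_code empty_in_code by auto
  have "vscale V (of_nat (card C)) (factor_mode i m v) \<in> S"
    unfolding factor_mode_combination[OF \<open>i \<in> I\<close>]
    by (intro power.subspace_sum[OF S] power.subspace_scale[OF S] inv \<open>v \<in> S\<close>)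
  then have "vscale V (1 / of_nat (card C)) (vscale V (of_nat (card C)) (factor_mode i m v)) \<in> S"
    by (rule power.subspace_scale[OF S])
  then show ?thesis using nz by simp
qed

section \<open>The lattice of monomials and its closure under products\<close>

inductive monomial :: "int \<Rightarrow> 'b \<Rightarrow> bool" where
  vacuum: "monomial 0 (vacuum V)"
| mode: "T \<in> C \<Longrightarrow> m \<le> -2 \<Longrightarrow> monomial N x \<Longrightarrow> monomial (N - m) (signed_mode T m x)"

text \<open>The modes in a monomial come in any order, and relations between monomials are allowed;
  hence prefixing a mode of index at most -2 always gives a monomial again.\<close>

definition lattice :: "'b set" where
  "lattice = Z.span {x. \<exists>N. monomial N x}"

lemma lattice_subspace: "Z.subspace lattice"
  unfolding lattice_def by (rule Z.subspace_span)

lemma monomial_in_lattice: "monomial N x \<Longrightarrow> x \<in> lattice"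
  unfolding lattice_def by (intro Z.span_base) auto

lemma lattice_induct:
  assumes "x \<in> lattice" "Z.subspace S" "\<And>N x. monomial N x \<Longrightarrow> x \<in> S"
  shows "x \<in> S"
  using assms Z.span_minimal[of "{x. \<exists>N. monomial N x}" S] by (auto simp: lattice_def)

lemma signed_mode_int_hom:
  "module_hom (\<lambda>k::int. vscale V (of_int k)) (\<lambda>k::int. vscale V (of_int k)) (signed_mode T m)"
  using signed_mode_hom[of T m] by (simp add: module_hom_iff Z.module_axioms)

text \<open>The central term is integral because 6 divides \<open>m ^ 3 - m\<close> and the
  remaining factor is the integer supplied by \<open>central_charge_integral\<close>. The rest of
  the bracket is a mode applied to \<open>x\<close>, which \<open>inv\<close> covers.\<close>

lemma signed_mode_monomial_commute:
  assumes ST: "S \<in> C" "T \<in> C" and x: "x \<in> lattice"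
    and inv: "\<And>T m. T \<in> C \<Longrightarrow> signed_mode T m x \<in> lattice"
  shows "signed_mode T m (signed_mode S p x) - signed_mode S p (signed_mode T m x) \<in> lattice"
proof -
  let ?k = "c / 2 * (of_nat (card I) - 2 * of_nat (card (sym_diff T S)))"
  have "6 dvd m ^ 3 - m"
  proof -
    have "m mod 6 \<in> {0, 1, 2, 3, 4, 5}" by auto
    then have "(m ^ 3 - m) mod 6 = 0"
      by (auto simp: mod_diff_eq[symmetric, of "m ^ 3" m] power_mod[symmetric, of m 3])
    then show ?thesis by presburger
  qed
  then obtain q where q: "m ^ 3 - m = 6 * q" by blast
  have "?k \<in> \<int>"
    using ST by (intro central_charge_integral sym_diff_in_code)
  then obtain k where k: "?k = of_int k" by (auto elim: Ints_cases)
  have *: "of_int (m ^ 3 - m) / 12 * c *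
      (of_nat (card I) - 2 * of_nat (card (sym_diff T S))) = (of_int (q * k) :: complex)"
    unfolding q of_int_mult k[symmetric] by simp
  have "vscale V (of_int (m - p)) (signed_mode (sym_diff T S) (m + p) x) \<in> lattice"
    using inv[OF sym_diff_in_code[OF ST(2,1)]] by (rule Z.subspace_scale[OF lattice_subspace])
  moreover have "(if m + p = 0 then vscale V (of_int (q * k)) x else 0) \<in> lattice"
    using Z.subspace_scale[OF lattice_subspace x, of "q * k"] Z.subspace_0[OF lattice_subspace]
    by simp
  ultimately show ?thesis
    unfolding signed_mode_bracket[OF code_subset code_subset, OF ST] *
    by (rule Z.subspace_add[OF lattice_subspace])
qed

text \<open>Induction on the monomial: the new mode is moved past the leftmost one. The exchanged
  product and the commutator both let modes of arbitrary index act on the shorter monomial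
  only.\<close>

lemma signed_mode_lattice:
  assumes "T \<in> C" "x \<in> lattice"
  shows "signed_mode T m x \<in> lattice"
proof -
  have mono: "signed_mode T m x \<in> lattice" if "monomial N x" "T \<in> C" for N T m x
    using that
  proof (induction arbitrary: T m)
    case vacuum
    show ?case
    proof (cases "m \<le> -2")
      case True
      then show ?thesis
        using monomial_in_lattice[OF mode[OF vacuum True monomial.vacuum]] by simp
    next
      case False
      then show ?thesis
        using Z.subspace_0[OF lattice_subspace] by (simp add: signed_mode_vacuum)
    qed
  next
    case (mode S p N x)
    \<comment> \<open>Here \<open>p\<close> is at most -2, so the mode sends monomials to monomials
      and preserves their span.\<close>
    have "signed_mode S p y \<in> lattice" if "y \<in> lattice" for y
    proof (rule lattice_induct[OF that, of "signed_mode S p -` lattice", simplified])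
      show "Z.subspace (signed_mode S p -` lattice)"
        by (rule module_hom.subspace_vimage[OF signed_mode_int_hom]) (rule lattice_subspace)
      show "signed_mode S p x \<in> lattice" if "monomial N x" for N x
        using monomial_in_lattice[OF monomial.mode[OF mode.hyps(1,2) that]] .
    qed
    then have 1: "signed_mode S p (signed_mode T m x) \<in> lattice"
      using mode.IH mode.prems by blast
    have 2: "signed_mode T m (signed_mode S p x) - signed_mode S p (signed_mode T m x) \<in> lattice"
      using mode.hyps mode.prems mode.IH monomial_in_lattice
      by (intro signed_mode_monomial_commute) auto
    show ?case
      using Z.subspace_add[OF lattice_subspace 1 2] by simp
  qed
  show ?thesis
  proof (rule lattice_induct[OF assms(2), of "signed_mode T m -` lattice", simplified])
    show "Z.subspace (signed_mode T m -` lattice)"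
      by (rule module_hom.subspace_vimage[OF signed_mode_int_hom]) (rule lattice_subspace)
  qed (use mono assms(1) in blast)
qed

lemma vacuum_in_lattice: "vacuum V \<in> lattice"
  by (rule monomial_in_lattice) (rule monomial.vacuum)

lemma prod_int_hom:
  "module_hom (\<lambda>k::int. vscale V (of_int k)) (\<lambda>k::int. vscale V (of_int k)) (\<lambda>u. vprod V u m v)"
  using power.prod_hom_left[of m v] by (simp add: module_hom_iff Z.module_axioms)

text \<open>The vectors all of whose products preserve the lattice form a subgroup. It contains the
  vacuum and, by the iterate formula, is stable under the generating modes, so it contains every
  monomial.\<close>

lemma prod_lattice:
  assumes u: "u \<in> lattice" and w: "w \<in> lattice"
  shows "vprod V u m w \<in> lattice"
proof -
  define G where "G = {u. \<forall>m. \<forall>w\<in>lattice. vprod V u m w \<in> lattice}"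
  have "G = (\<Inter>m. \<Inter>w\<in>lattice. (\<lambda>u. vprod V u m w) -` lattice)"
    by (auto simp: G_def)
  moreover have "Z.subspace ((\<lambda>u. vprod V u m w) -` lattice)" for m w
    by (rule module_hom.subspace_vimage[OF prod_int_hom]) (rule lattice_subspace)
  ultimately have "Z.subspace G"
    by (auto intro!: Z.subspace_Inter)
  moreover have "x \<in> G" if "monomial N x" for N x
    using that
  proof induction
    case vacuum
    show ?case
      using Z.subspace_0[OF lattice_subspace] by (simp add: G_def power.vacuum_left)
  next
    case (mode T m N x)
    have "vprod V (signed_conformal I L \<tau> T) p w \<in> lattice" if "w \<in> lattice" for p w
      using signed_mode_lattice[OF mode.hyps(1) that, of "p - 1"] by (simp add: signed_mode_def)
    then show ?case
      using mode.IH unfolding G_def signed_mode_def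
      by (auto intro!: power.prod_preserves_subgroup lattice_subspace)
  qed
  ultimately have "u \<in> G" by (rule lattice_induct[OF u])
  then show ?thesis using w by (simp add: G_def)
qed

lemma lattice_vertex_subring: "vertex_subring V lattice"
  unfolding vertex_subring_def
  using Z.subspace_0[OF lattice_subspace] Z.subspace_add[OF lattice_subspace]
    Z.subspace_neg[OF lattice_subspace] vacuum_in_lattice prod_lattice by blast

lemma signed_conformal_in_lattice:
  assumes "T \<in> C"
  shows "signed_conformal I L \<tau> T \<in> lattice"
  \<comment> \<open>Because of the shift, the mode -2 is the product of index -1, and creation
    returns the vector itself.\<close>
  using signed_mode_lattice[OF assms vacuum_in_lattice, of "-2"]
  by (simp add: signed_mode_def power.creation)

lemma generated_eq_lattice:
  "generated_vertex_subring V (signed_conformal I L \<tau> ` C) = lattice"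
proof
  show "generated_vertex_subring V (signed_conformal I L \<tau> ` C) \<subseteq> lattice"
    unfolding generated_vertex_subring_def
    using lattice_vertex_subring signed_conformal_in_lattice by blast
  show "lattice \<subseteq> generated_vertex_subring V (signed_conformal I L \<tau> ` C)"
    unfolding generated_vertex_subring_def
  proof (intro Inter_greatest subsetI)
    fix R x
    assume "R \<in> {R. vertex_subring V R \<and> signed_conformal I L \<tau> ` C \<subseteq> R}" and x: "x \<in> lattice"
    then have R: "vertex_subring V R" and gen: "\<And>T. T \<in> C \<Longrightarrow> signed_conformal I L \<tau> T \<in> R"
      by auto
    have "Z.subspace R"
      using R by (intro int_subspaceI power.vector_space_axioms) (auto simp: vertex_subring_def)
    moreover have "x \<in> R" if "monomial N x" for N x
      using that
    proof induction
      case vacuum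
      show ?case using R by (simp add: vertex_subring_def)
    next
      case (mode T m N x)
      then show ?case using R gen by (simp add: vertex_subring_def signed_mode_def)
    qed
    ultimately show "x \<in> R" by (rule lattice_induct[OF x])
  qed
qed

text \<open>The complex span contains the vacuum and is stable under the signed modes, hence under
  the factor modes by Fourier inversion.\<close>

lemma lattice_span: "power.span lattice = UNIV"
proof -
  have "signed_mode T m v \<in> power.span lattice" if "T \<in> C" "v \<in> power.span lattice" for T m v
  proof -
    have "power.subspace (signed_mode T m -` power.span lattice)"
      by (rule module_hom.subspace_vimage[OF signed_mode_hom]) (rule power.subspace_span)
    then have "power.span lattice \<subseteq> signed_mode T m -` power.span lattice"
      using signed_mode_lattice[OF that(1)] power.span_base by (intro power.span_minimal) auto
    then show ?thesis using that(2) by blast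
  qed
  note inv = factor_mode_invariant[OF power.subspace_span this]
  have "v \<in> power.span lattice" for v
    by (rule tensor_eq_spanI[OF power.subspace_span power.span_base[OF vacuum_in_lattice] inv])
  then show ?thesis by blast
qed

section \<open>Weights and integral functionals\<close>

lemma monomial_weight: "monomial N x \<Longrightarrow> x \<in> weight_space V N"
proof (induction rule: monomial.induct)
  case vacuum
  show ?case by (simp add: weight_space_def Lop_eq_signed_mode signed_mode_vacuum)
next
  case (mode T m N x)
  \<comment> \<open>\<open>L(0)\<close> is a mode of the empty codeword; the central term disappears
    because its coefficient contains \<open>0 ^ 3 - 0\<close>.\<close>
  have "signed_mode {} 0 (signed_mode T m x) - signed_mode T m (signed_mode {} 0 x) =
      vscale V (- of_int m) (signed_mode T m x)"
    using signed_mode_bracket[OF code_subset[OF mode.hyps(1)] empty_subsetI, of 0 m x] by simp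
  then show ?case
    using mode.IH
    by (simp add: weight_space_def Lop_eq_signed_mode signed_mode_simps algebra_simps)
qed

text \<open>Every mode adds at least 2 to the weight, so the vacuum is the only monomial of weight
  0.\<close>

lemma monomial_weight_pos: "monomial N x \<Longrightarrow> N = 0 \<and> x = vacuum V \<or> N > 0"
  by (induction rule: monomial.induct) auto

text \<open>
  On the lattice only the coefficient of the vacuum is seen by the tensor power of a functional that
  vanishes on the image of \<open>L(0)\<close>, so this functional and its compositions with the generating modes
  are integral there.
\<close>

lemma integral_functionals_separate:
  assumes "v \<noteq> 0"
  shows "\<exists>\<phi>. Vector_Spaces.linear (vscale V) (*) \<phi> \<and> \<phi> ` lattice \<subseteq> \<int> \<and> \<phi> v \<noteq> 0"
proof -
  obtain \<epsilon> where \<epsilon>: "Vector_Spaces.linear (vscale L) (*) \<epsilon>" "\<epsilon> (vacuum L) = 1"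
    "\<And>x. \<epsilon> (Lop L 0 x) = 0"
    using vacuum_functional_exists by blast
  define E where "E = tensor_functional (\<lambda>_. \<epsilon>)"
  have E: "module_hom (vscale V) (*) E"
    unfolding E_def by (rule tensor_functional_hom) (rule \<epsilon>(1))
  have E_tensor: "E (\<tau> u) = (\<Prod>i\<in>I. \<epsilon> (u i))" if "u \<in> I \<rightarrow>\<^sub>E UNIV" for u
    unfolding E_def using \<epsilon>(1) that by (intro tensor_functional_tensor)
  have "E (factor_mode i 0 v) = 0" if i: "i \<in> I" for i v
  proof (rule hom_eqI[where s = "(*)" and f = "\<lambda>v. E (factor_mode i 0 v)" and g = "\<lambda>_. 0" and v = v])
    show "module_hom (vscale V) (*) (\<lambda>v. E (factor_mode i 0 v))"
      using module_hom_compose[OF factor_mode_hom E] by (simp add: comp_def)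
    then show "module_hom (vscale V) (*) (\<lambda>_. 0 :: complex)"
      by (simp add: module_hom_iff)
    show "E (factor_mode i 0 (\<tau> u)) = 0" if u: "u \<in> I \<rightarrow>\<^sub>E UNIV" for u
    proof -
      have "(\<Prod>k\<in>I. \<epsilon> ((u(i := Lop L 0 (u i))) k)) = 0"
        by (rule prod_zero) (use finite_index i \<epsilon>(3) in auto)
      then show ?thesis
        using E_tensor[of "u(i := Lop L 0 (u i))"] u i by (simp add: factor_mode_tensor)
    qed
  qed
  \<comment> \<open>\<open>L(0)\<close> is the sum of the modes of index 0 in the single positions,
    and \<open>E\<close> kills the image of each.\<close>
  then have E_Lop: "E (Lop V 0 v) = 0" for v
    by (simp add: Lop_eq_signed_mode signed_mode_eq module_hom.sum[OF E])
  have E_monomial: "E x \<in> \<int>" if "monomial N x" for N x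
  proof (cases "N = 0")
    case True
    then have "x = vacuum V" using monomial_weight_pos[OF that] by simp
    then show ?thesis
      by (simp add: vacuum_eq E_tensor \<epsilon>(2) cong: prod.cong)
  next
    case False
    \<comment> \<open>In nonzero weight the eigenvalue equation forces \<open>E x = 0\<close>; at
      the vacuum the value of \<open>E\<close> is 1.\<close>
    have "of_int N * E x = E (Lop V 0 x)"
      using monomial_weight[OF that] by (simp add: weight_space_def module_hom.scale[OF E])
    then show ?thesis using False E_Lop by simp
  qed
  define \<Phi> where "\<Phi> = {\<phi>. module_hom (vscale V) (*) \<phi> \<and> \<phi> ` lattice \<subseteq> \<int>}"
  have "Z.subspace (E -` \<int>)"
    unfolding Z.subspace_def
    by (auto simp: module_hom.add[OF E] module_hom.scale[OF E] module_hom.zero[OF E])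
  then have "E ` lattice \<subseteq> \<int>"
    using lattice_induct[of _ "E -` \<int>"] E_monomial by auto
  then have "E \<in> \<Phi>" using E by (simp add: \<Phi>_def)
  have mode: "(\<lambda>v. \<phi> (signed_mode T m v)) \<in> \<Phi>" if "\<phi> \<in> \<Phi>" "T \<in> C" for \<phi> T m
    using that module_hom_compose[OF signed_mode_hom, of "(*)" \<phi> T m] signed_mode_lattice[OF that(2)]
    by (auto simp: \<Phi>_def comp_def)
  \<comment> \<open>The common kernel of the integral functionals is stable under the generating
    modes and lies in the kernel of \<open>E\<close>, so irreducibility of the factors makes it
    0.\<close>
  define U where "U = {v. \<forall>\<phi>\<in>\<Phi>. \<phi> v = 0}"
  have U: "power.subspace U"
    unfolding power.subspace_def U_def \<Phi>_def
    by (auto simp: module_hom.add module_hom.scale module_hom.zero)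
  have "signed_mode T m v \<in> U" if "T \<in> C" "v \<in> U" for T m v
    using that mode by (auto simp: U_def)
  note inv = factor_mode_invariant[OF U this]
  have "w = 0" if "w \<in> U" for w
  proof (rule invariant_subspace_trivial[OF U inv \<epsilon>(1)])
    show "\<epsilon> (vacuum L) \<noteq> 0" using \<epsilon>(2) by simp
    show "tensor_functional (\<lambda>_. \<epsilon>) v = 0" if "v \<in> U" for v
      using that \<open>E \<in> \<Phi>\<close> by (auto simp: U_def E_def)
  qed (use that in auto)
  then have "v \<notin> U" using assms by blast
  then show ?thesis by (auto simp: U_def \<Phi>_def module_hom_iff_linear)
qed

section \<open>Grading and bases of the lattice\<close>

lemma weight_lattice_subspace: "Z.subspace (weight_space V m \<inter> lattice)"
proof (intro Z.subspace_inter lattice_subspace)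
  show "Z.subspace (weight_space V m)"
    using power.weight_space_subspace by (simp add: Z.subspace_def power.subspace_def)
qed

text \<open>Monomials are homogeneous lattice vectors, and the vectors with such a decomposition
  form a subgroup.\<close>

lemma lattice_weight_decomposition:
  assumes "x \<in> lattice"
  shows "\<exists>f. finite {m. f m \<noteq> 0} \<and> (\<forall>m. f m \<in> weight_space V m \<inter> lattice) \<and> x = Sum_any f"
proof -
  define W where "W m = weight_space V m \<inter> lattice" for m
  define S where "S = {x. \<exists>f. finite {m. f m \<noteq> 0} \<and> (\<forall>m. f m \<in> W m) \<and> x = Sum_any f}"
  note W = weight_lattice_subspace[folded W_def]
  have S_I: "Sum_any f \<in> S" if "finite {m. f m \<noteq> 0}" "\<And>m. f m \<in> W m" for f
    using that by (auto simp: S_def)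
  have "x \<in> S"
    using assms
  proof (rule lattice_induct)
    show "Z.subspace S"
    proof (rule int_subspaceI[OF power.vector_space_axioms])
      show "0 \<in> S"
        using S_I[of "\<lambda>_. 0"] Z.subspace_0[OF W] by simp
      show "x + y \<in> S" if "x \<in> S" "y \<in> S" for x y
      proof -
        obtain f g where f: "finite {m. f m \<noteq> 0}" "\<And>m. f m \<in> W m" "x = Sum_any f"
          and g: "finite {m. g m \<noteq> 0}" "\<And>m. g m \<in> W m" "y = Sum_any g"
          using \<open>x \<in> S\<close> \<open>y \<in> S\<close> unfolding S_def by blast
        have "finite {m. f m + g m \<noteq> 0}"
          by (rule finite_subset[OF _ finite_UnI[OF f(1) g(1)]]) auto
        then have "Sum_any (\<lambda>m. f m + g m) \<in> S"
          by (rule S_I) (rule Z.subspace_add[OF W f(2) g(2)])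
        then show ?thesis
          using f g by (simp add: Sum_any.distrib)
      qed
      show "- x \<in> S" if "x \<in> S" for x
      proof -
        obtain f where f: "finite {m. f m \<noteq> 0}" "\<And>m. f m \<in> W m" "x = Sum_any f"
          using \<open>x \<in> S\<close> unfolding S_def by blast
        have "Sum_any (\<lambda>m. - f m) \<in> S"
          using f(1) Z.subspace_neg[OF W f(2)] by (intro S_I) simp_all
        then show ?thesis
          by (simp add: f(3) Sum_any.expand_set sum_negf)
      qed
    qed
    show "x \<in> S" if x: "monomial N x" for N x
    proof -
      let ?f = "\<lambda>m. if m = N then x else 0"
      have sub: "{m. ?f m \<noteq> 0} \<subseteq> {N}" by auto
      have "?f m \<in> W m" for m
        using monomial_weight[OF x] monomial_in_lattice[OF x] Z.subspace_0[OF W[of m]]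
        by (auto simp: W_def)
      then have "Sum_any ?f \<in> S"
        by (intro S_I finite_subset[OF sub]) simp_all
      moreover have "Sum_any ?f = sum ?f {N}"
        using sub by (intro Sum_any.expand_superset) simp_all
      ultimately show ?thesis by simp
    qed
  qed
  then show ?thesis by (simp add: S_def W_def)
qed

lemma lattice_coproduct: "is_coproduct lattice (\<lambda>m. weight_space V m \<inter> lattice)"
  unfolding is_coproduct_def
proof (intro conjI ballI allI)
  fix v assume "v \<in> lattice"
  from lattice_weight_decomposition[OF this]
  show "\<exists>!f. finite {m. f m \<noteq> 0} \<and> (\<forall>m. f m \<in> weight_space V m \<inter> lattice) \<and> v = Sum_any f"
  proof (rule ex_ex1I, goal_cases)
    case (1 f g)
    then show ?case
      by (intro power.weight_decomposition_unique) auto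
  qed
qed simp

text \<open>Each weight piece has a basis by \<open>lattice_basis\<close>. The union of these bases
  is independent by the grading, spans the lattice over the integers by the weight decomposition,
  and hence spans \<open>V\<close> over the complex numbers.\<close>

theorem lattice_integral_form: "integral_form V lattice"
proof -
  have "\<exists>B. power.independent B \<and> weight_space V m \<inter> lattice = Z.span B" for m
  proof -
    obtain F where F: "finite F" "power.span F = weight_space V m"
      using power.weight_space_finite_dim by blast
    show ?thesis
    proof (rule lattice_basis[where F = F and
          \<Phi> = "{\<phi>. Vector_Spaces.linear (vscale V) (*) \<phi> \<and> \<phi> ` lattice \<subseteq> \<int>}"])
    qed (use F weight_lattice_subspace integral_functionals_separate power.vector_space_axioms in auto)
  qed
  then obtain B where ind: "\<And>m. power.independent (B m)"
    and B: "\<And>m. weight_space V m \<inter> lattice = Z.span (B m)"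
    by metis
  have B_sub: "B m \<subseteq> weight_space V m \<inter> lattice" for m
    unfolding B by (rule Z.span_superset)
  have "power.independent (\<Union>m. B m)"
    using ind B_sub by (intro power.independent_weight_union) auto
  moreover have lattice_eq: "lattice = Z.span (\<Union>m. B m)"
  proof
    show "Z.span (\<Union>m. B m) \<subseteq> lattice"
      using B_sub by (intro Z.span_minimal lattice_subspace) auto
    show "lattice \<subseteq> Z.span (\<Union>m. B m)"
    proof
      fix x assume "x \<in> lattice"
      then obtain f where f: "\<And>m. f m \<in> weight_space V m \<inter> lattice" "x = Sum_any f"
        using lattice_weight_decomposition by blast
      have "f m \<in> Z.span (\<Union>m. B m)" for m
        using f(1)[of m] Z.span_mono[of "B m" "\<Union>m. B m"] unfolding B by blast
      then show "x \<in> Z.span (\<Union>m. B m)"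
        unfolding f(2) Sum_any.expand_set by (intro Z.span_sum)
    qed
  qed
  moreover have "power.span (\<Union>m. B m) = UNIV"
  proof -
    have "Z.subspace (power.span (\<Union>m. B m))"
      by (rule int_subspaceI[OF power.vector_space_axioms])
        (auto intro: power.span_zero power.span_add power.span_neg)
    then have "lattice \<subseteq> power.span (\<Union>m. B m)"
      unfolding lattice_eq by (intro Z.span_minimal power.span_superset)
    then show ?thesis
      using power.span_minimal[OF _ power.subspace_span] lattice_span by blast
  qed
  ultimately show ?thesis
    unfolding integral_form_def using lattice_vertex_subring lattice_coproduct by blast
qed

end

theorem theorem5p3:
  fixes n :: nat and \<Omega> :: "nat set" and C :: "nat set set"
    and L :: "'a::ab_group_add vertex_data"
    and V :: "'b::ab_group_add vertex_data"
    and \<tau> :: "(nat \<Rightarrow> 'a) \<Rightarrow> 'b"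
  assumes "n > 0" and "4 dvd n" and "\<Omega> = {1..n}"
    and "is_virasoro_voa (1/2) L"
    and "is_tensor_power_voa \<Omega> (1/2) L V \<tau>"
    and "binary_linear_code \<Omega> C" and "C \<subseteq> even_subsets \<Omega>" and "\<Omega> \<in> C"
    and "\<And>i j. i \<in> \<Omega> \<Longrightarrow> j \<in> \<Omega> \<Longrightarrow> i \<noteq> j \<Longrightarrow> \<exists>T\<in>C. i \<in> T \<and> j \<notin> T"
  shows "integral_form V (generated_vertex_subring V (signed_conformal \<Omega> L \<tau> ` C)) \<and>
    conformal V \<in> generated_vertex_subring V (signed_conformal \<Omega> L \<tau> ` C)"
proof -
  interpret virasoro_code_generators \<Omega> "1/2" L V \<tau> C
  proof
    fix T assume "T \<in> C"
    then have "even (card T)" using assms(7) by (auto simp: even_subsets_def)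
    then obtain l where l: "card T = 2 * l" by blast
    obtain k where k: "n = 4 * k" using assms(2) by blast
    \<comment> \<open>At central charge 1/2 the condition asks for
      \<open>(n - 2 * card T) / 4\<close> to be an integer, which holds since 4 divides
      \<open>n\<close> and \<open>card T\<close> is even.\<close>
    have "(1/2) / 2 * (of_nat (card \<Omega>) - 2 * of_nat (card T)) = (of_nat k - of_nat l :: complex)"
      using assms(3) by (simp add: k l field_simps)
    then show "(1/2) / 2 * (of_nat (card \<Omega>) - 2 * of_nat (card T)) \<in> (\<int> :: complex set)"
      by (simp only: Ints_diff Ints_of_nat)
  qed (use assms in auto)
  \<comment> \<open>The conformal vector is the generator attached to the empty codeword.\<close>
  show ?thesis
    unfolding generated_eq_lattice conformal_eq_signed
    using lattice_integral_form signed_conformal_in_lattice[OF empty_in_code] by blast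
qed

end
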